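(* Let $G$ be a connected $k$-regular graph with $n$ vertices and $m$ unoriented edges, with $k>2$ and girth $g(G)>4$. Let $\mathbf{A}(G)$ be its adjacency matrix, $\mathbf{U}$ its Grover transition matrix, and $\mathbf{Z}_3(G,u)=\det(\mathbf{I}_{2m}-u(\mathbf{U}^3)^+)^{-1}$ its 3-modified zeta function. Then $\mathbf{Z}_3(G,u)$ has $2n$ poles $\rho_3$ of the form $$\rho_3=\frac{\lambda_A(\lambda_A^2-3k+4)\pm\sqrt{\lambda_A^6-2(3k-2)\lambda_A^4+(13k^2-24k+16)\lambda_A^2-8(k-1)(k^2-2k+2)}}{2\big(\lambda_A^4-k^2\lambda_A^2+2(k-1)(k^2-2k+2)\big)},$$ where $\lambda_A$ is an eigenvalue of $\mathbf{A}(G)$. The remaining $2(m-n)$ poles of $\mathbf{Z}_3(G,u)$ are $\pm1/2$, each with multiplicity $m-n$.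
   Context: Graphs are finite and may have multiple edges and loops. $D(G)=\{(u,v),(v,u)\mid uv\in E(G)\}$ is the set of arcs, two mutually inverse arcs for each edge; for an arc $e=(u,v)$ put $o(e)=u$, $t(e)=v$, $e^{-1}=(v,u)$. The degree $d_v=\deg v$ is the number of edges incident to $v$; $G$ is $k$-regular if $\deg v=k$ for every vertex $v$. A cycle is a sequence $C=(v_0,e_1,v_1,\dots,v_{s-1},e_s,v_s)$ with $e_i\in D(G)$, $o(e_i)=v_{i-1}$, $t(e_i)=v_i$ and $v_0=v_s$; it is reduced if $e_{i+1}^{-1}\neq e_i$ for $1\le i\le s-1$. A (reduced) cycle is essential if all its vertices except $v_0,v_s$ are distinct and $s\ge2$. The girth $g(G)$ is the minimum length $s$ of essential cycles in $G$. The Grover transition matrix $\mathbf{U}=(U_{ef})_{e,f\in D(G)}$ is defined by $U_{ef}=2/d_{t(f)}$ if $t(f)=o(e)$ and $f\ne e^{-1}$; $U_{ef}=2/d_{t(f)}-1$ if $f=e^{-1}$; and $U_{ef}=0$ otherwise. The positive support $\mathbf{F}^+$ of a real square matrix $\mathbf{F}$ has $F^+_{ij}=1$ if $F_{ij}>0$ and $0$ otherwise. Poles are counted with multiplicity, and square roots are complex square roots.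
   Formalization: The formula for the 2n poles is claimed only if its denominator vanishes at no eigenvalue (it does for the Petersen graph, λ_A = -2); otherwise each such eigenvalue gives only the finite root 1/(λ_A(λ_A²-3k+4)), or none if that product is 0. *)

theory Defs
  imports
    "HOL-Complex_Analysis.Complex_Analysis"
    "Jordan_Normal_Form.Char_Poly"
    "Graph_Theory.Graph_Theory"
begin

text \<open>
  A finite graph, possibly with loops and multiple edges, is a finite digraph \<open>G\<close> whose arcs are
  the elements of \<open>D(G)\<close>, together with a map \<open>arev\<close> such that \<open>bidirected_digraph G arev\<close>: on the
  arcs \<open>arev\<close> is a fixed-point-free involution exchanging tail and head. A loop therefore
  contributes two distinct mutually inverse arcs, and \<open>card (arcs G) = 2 * num_edges G arev\<close>.
\<close>

definition uedges :: "('v, 'e) pre_digraph \<Rightarrow> ('e \<Rightarrow> 'e) \<Rightarrow> 'e set set" where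
  "uedges G arev = (\<lambda>e. {e, arev e}) ` arcs G"

definition num_edges :: "('v, 'e) pre_digraph \<Rightarrow> ('e \<Rightarrow> 'e) \<Rightarrow> nat" where
  "num_edges G arev = card (uedges G arev)"

text \<open>
  A loop counts once in this degree; graphs of girth greater than 2 have no loops (see below).
\<close>

definition deg :: "('v, 'e) pre_digraph \<Rightarrow> ('e \<Rightarrow> 'e) \<Rightarrow> 'v \<Rightarrow> nat" where
  "deg G arev v = card {E \<in> uedges G arev. \<exists>e\<in>E. tail G e = v}"

definition regular :: "('v, 'e) pre_digraph \<Rightarrow> ('e \<Rightarrow> 'e) \<Rightarrow> nat \<Rightarrow> bool" where
  "regular G arev k \<longleftrightarrow> (\<forall>v\<in>verts G. deg G arev v = k)"

definition reduced :: "('e \<Rightarrow> 'e) \<Rightarrow> 'e list \<Rightarrow> bool" where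
  "reduced arev p \<longleftrightarrow> (\<forall>i. Suc i < length p \<longrightarrow> arev (p ! Suc i) \<noteq> p ! i)"

text \<open>
  The vertices of a cycle other than \<open>v\<^sub>0\<close> and \<open>v\<^sub>s\<close>, which have to be pairwise distinct, are
  \<open>v\<^sub>1, \<dots>, v\<^bsub>s-1\<^esub>\<close>. Running twice through a loop in the same direction is thus an essential cycle
  of length 2, just like a pair of parallel edges.
\<close>

definition essential_cycle :: "('v, 'e) pre_digraph \<Rightarrow> ('e \<Rightarrow> 'e) \<Rightarrow> 'e list \<Rightarrow> bool" where
  "essential_cycle G arev p \<longleftrightarrow>
     (\<exists>v. pre_digraph.awalk G v p v \<and> reduced arev p \<and> 2 \<le> length p \<and>
          distinct (butlast (tl (pre_digraph.awalk_verts G v p))))"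

definition girth :: "('v, 'e) pre_digraph \<Rightarrow> ('e \<Rightarrow> 'e) \<Rightarrow> enat" where
  "girth G arev = (INF p \<in> {p. essential_cycle G arev p}. enat (length p))"

text \<open>
  Matrices indexed by vertices or arcs are written with respect to an enumeration of the index
  set by a list without repetitions.
\<close>

definition adjacency_mat :: "('v, 'e) pre_digraph \<Rightarrow> 'v list \<Rightarrow> real mat" where
  "adjacency_mat G vs = mat (length vs) (length vs)
     (\<lambda>(i, j). real (card {e \<in> arcs G. tail G e = vs ! i \<and> head G e = vs ! j}))"

definition grover_entry :: "('v, 'e) pre_digraph \<Rightarrow> ('e \<Rightarrow> 'e) \<Rightarrow> 'e \<Rightarrow> 'e \<Rightarrow> real" where
  "grover_entry G arev e f =
     (if head G f = tail G e \<and> f \<noteq> arev e then 2 / real (deg G arev (head G f))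
      else if f = arev e then 2 / real (deg G arev (head G f)) - 1
      else 0)"

definition grover_mat :: "('v, 'e) pre_digraph \<Rightarrow> ('e \<Rightarrow> 'e) \<Rightarrow> 'e list \<Rightarrow> real mat" where
  "grover_mat G arev es =
     mat (length es) (length es) (\<lambda>(i, j). grover_entry G arev (es ! i) (es ! j))"

definition pos_support :: "real mat \<Rightarrow> real mat" where
  "pos_support F = map_mat (\<lambda>x. if x > 0 then 1 else 0) F"

definition zeta3 :: "('v, 'e) pre_digraph \<Rightarrow> ('e \<Rightarrow> 'e) \<Rightarrow> 'e list \<Rightarrow> complex \<Rightarrow> complex" where
  "zeta3 G arev es u =
     inverse (det (1\<^sub>m (2 * num_edges G arev) -
       u \<cdot>\<^sub>m map_mat complex_of_real (pos_support (grover_mat G arev es ^\<^sub>m 3))))"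

definition pole_mult :: "(complex \<Rightarrow> complex) \<Rightarrow> complex \<Rightarrow> nat" where
  "pole_mult f z = (if is_pole f z then nat (- zorder f z) else 0)"

text \<open>Eigenvalues of a real square matrix, repeated according to algebraic multiplicity.\<close>

definition spectrum_mset :: "real mat \<Rightarrow> complex multiset" where
  "spectrum_mset A = proots (char_poly (map_mat complex_of_real A))"

definition rho3_trace :: "nat \<Rightarrow> complex \<Rightarrow> complex" where
  "rho3_trace k l = l * (l^2 - 3 * of_nat k + 4)"

definition rho3_disc :: "nat \<Rightarrow> complex \<Rightarrow> complex" where
  "rho3_disc k l =
     l^6 - 2 * (3 * of_nat k - 2) * l^4 + (13 * (of_nat k)^2 - 24 * of_nat k + 16) * l^2
     - 8 * (of_nat k - 1) * ((of_nat k)^2 - 2 * of_nat k + 2)"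

definition rho3_den :: "nat \<Rightarrow> complex \<Rightarrow> complex" where
  "rho3_den k l =
     l^4 - (of_nat k)^2 * l^2 + 2 * (of_nat k - 1) * ((of_nat k)^2 - 2 * of_nat k + 2)"

definition rho3_plus :: "nat \<Rightarrow> complex \<Rightarrow> complex" where
  "rho3_plus k l = (rho3_trace k l + csqrt (rho3_disc k l)) / (2 * rho3_den k l)"

definition rho3_minus :: "nat \<Rightarrow> complex \<Rightarrow> complex" where
  "rho3_minus k l = (rho3_trace k l - csqrt (rho3_disc k l)) / (2 * rho3_den k l)"

text \<open>
  The two values \<open>rho3_plus k l\<close>, \<open>rho3_minus k l\<close> are the roots of
  \<open>1 - rho3_trace k l * u + rho3_den k l * u\<^sup>2\<close>. If \<open>rho3_den k l = 0\<close>, which happens exactly for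
  \<open>l\<^sup>2 = 2 (k - 1)\<close> and \<open>l\<^sup>2 = (k - 1)\<^sup>2 + 1\<close>, the fractions are undefined: a root has moved to
  infinity, and the only root left in the plane is \<open>1 / rho3_trace k l\<close>, or none if also
  \<open>rho3_trace k l = 0\<close>. Such eigenvalues do occur, e.g. -2 for the Petersen graph.
\<close>

definition rho3_values :: "nat \<Rightarrow> complex \<Rightarrow> complex multiset" where
  "rho3_values k l =
     (if rho3_den k l \<noteq> 0 then {#rho3_plus k l, rho3_minus k l#}
      else if rho3_trace k l \<noteq> 0 then {#1 / rho3_trace k l#}
      else {#})"

end

theory Submission
  imports Defs "Jordan_Normal_Form.Schur_Decomposition"
begin

text \<open>
  Let \<open>P = 2 / k\<close>, let \<open>S\<close> and \<open>H\<close> be the arc-vertex incidence matrices of tails and heads, and let \<open>J\<close> be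
  the permutation matrix of arc reversal. Then \<open>U = P S H\<^sup>t - J\<close>, and the entries of \<open>U\<^sup>3\<close> depend only on
  the numbers of arcs and of walks of length two between endpoints. As two vertices have at most one
  common neighbour, a case distinction shows that the positive support of \<open>U\<^sup>3\<close> is \<open>T\<^sup>3 + T\<^sup>t\<close> with
  \<open>T = S H\<^sup>t - J\<close>. Expanding with \<open>S\<^sup>t S = H\<^sup>t H = k I\<close>, \<open>S\<^sup>t H = A\<close>, \<open>J S = H\<close> writes it as \<open>X Y - 2 J\<close> with
  \<open>X = [S, H]\<close>. As \<open>J X\<close> is \<open>X\<close> with its two blocks exchanged, the identity
  \<open>det (c I - X Q) / c\<^sup>2\<^sup>m = det (c I - Q X) / c\<^sup>2\<^sup>n\<close> turns \<open>det (I - u (U\<^sup>3)\<^sup>+)\<close> into \<open>(1 - 4 u\<^sup>2)\<^sup>m\<^sup>-\<^sup>n\<close> times the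
  determinant of a block matrix of size \<open>2 n\<close> whose four blocks are polynomials in \<open>A\<close>. Triangularising \<open>A\<close>
  yields one quadratic factor in \<open>u\<close> for every eigenvalue. The points with \<open>1 = 4 u\<^sup>2\<close> can be
  ignored throughout, as the order of a pole is determined by a punctured neighbourhood.
\<close>

section \<open>Determinants and triangularisation\<close>

text \<open>The block matrix \<open>?F\<close> is reduced in two ways by unitriangular factors.
  Clearing \<open>Q\<close> with \<open>?L\<close> on the right leaves the Schur complement of
  \<open>1\<close>, which is \<open>c - P Q\<close>; clearing it with \<open>?K\<close> on the left
  leaves the Schur complement of \<open>c\<close>, which is \<open>1 - Q P / c\<close>. Powers of
  \<open>c\<close> stand on both sides, so neither \<open>N \<le> r\<close> nor
  \<open>r \<le> N\<close> has to be known.\<close>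

lemma det_weinstein_aronszajn:
  fixes P Q :: "'a :: field mat"
  assumes P: "P \<in> carrier_mat N r" and Q: "Q \<in> carrier_mat r N" and c: "c \<noteq> 0"
  shows "det (c \<cdot>\<^sub>m 1\<^sub>m N - P * Q) * c ^ r = c ^ N * det (c \<cdot>\<^sub>m 1\<^sub>m r - Q * P)"
proof -
  let ?F = "four_block_mat (c \<cdot>\<^sub>m 1\<^sub>m N) P Q (1\<^sub>m r)"
  let ?L = "four_block_mat (1\<^sub>m N) (0\<^sub>m N r) (- Q) (1\<^sub>m r)"
  let ?K = "four_block_mat (1\<^sub>m N) (0\<^sub>m N r) (- (inverse c \<cdot>\<^sub>m Q)) (1\<^sub>m r)"
  have F: "?F \<in> carrier_mat (N + r) (N + r)" and L: "?L \<in> carrier_mat (N + r) (N + r)"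
    and K: "?K \<in> carrier_mat (N + r) (N + r)"
    using P Q by auto
  have PQ: "P * Q \<in> carrier_mat N N" and QP: "Q * P \<in> carrier_mat r r"
    using P Q by auto
  have cPQ: "c \<cdot>\<^sub>m 1\<^sub>m N - P * Q \<in> carrier_mat N N"
    using PQ by (rule minus_carrier_mat)
  have cQP: "1\<^sub>m r - inverse c \<cdot>\<^sub>m (Q * P) \<in> carrier_mat r r"
    using QP by (intro minus_carrier_mat smult_carrier_mat)
  have detL: "det ?L = 1" and detK: "det ?K = 1"
    using Q by (simp_all add: det_four_block_mat_upper_right_zero[of _ N _ r])
  have FL: "?F * ?L = four_block_mat (c \<cdot>\<^sub>m 1\<^sub>m N - P * Q) P (0\<^sub>m r N) (1\<^sub>m r)"
    by (subst mult_four_block_mat[of _ N N _ r _ r _ _ N _ r])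
      (use P Q PQ in \<open>auto intro!: cong_four_block_mat eq_matI\<close>)
  have "det ?F = det (?F * ?L)"
    unfolding det_mult[OF F L] detL by simp
  also have "\<dots> = det (c \<cdot>\<^sub>m 1\<^sub>m N - P * Q) * det (1\<^sub>m r :: 'a mat)"
    unfolding FL by (rule det_four_block_mat_lower_left_zero[OF cPQ P refl]) simp
  finally have 1: "det ?F = det (c \<cdot>\<^sub>m 1\<^sub>m N - P * Q)"
    by simp
  have KF: "?K * ?F = four_block_mat (c \<cdot>\<^sub>m 1\<^sub>m N) P (0\<^sub>m r N) (1\<^sub>m r - inverse c \<cdot>\<^sub>m (Q * P))"
    by (subst mult_four_block_mat[of _ N N _ r _ r _ _ N _ r])
      (use P Q QP c in \<open>auto intro!: cong_four_block_mat eq_matI\<close>)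
  have "det ?F = det (?K * ?F)"
    unfolding det_mult[OF K F] detK by simp
  also have "\<dots> = det (c \<cdot>\<^sub>m 1\<^sub>m N) * det (1\<^sub>m r - inverse c \<cdot>\<^sub>m (Q * P))"
    unfolding KF by (rule det_four_block_mat_lower_left_zero[OF _ P refl cQP]) simp
  finally have 2: "det ?F = c ^ N * det (1\<^sub>m r - inverse c \<cdot>\<^sub>m (Q * P))"
    by simp
  have "c \<cdot>\<^sub>m (1\<^sub>m r - inverse c \<cdot>\<^sub>m (Q * P)) = c \<cdot>\<^sub>m 1\<^sub>m r - Q * P"
    using P Q c by (intro eq_matI) (auto simp: algebra_simps)
  then have 3: "det (c \<cdot>\<^sub>m 1\<^sub>m r - Q * P) = c ^ r * det (1\<^sub>m r - inverse c \<cdot>\<^sub>m (Q * P))"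
    using cQP by (metis det_smult carrier_matD(2))
  show ?thesis unfolding 1[symmetric] 2 3 by (rule mult.assoc[THEN trans]) (simp add: mult.commute)
qed

section \<open>Simultaneous triangularisation of polynomials in one matrix\<close>

text \<open>The witnesses \<open>P\<close>, \<open>Q\<close> are parameters, so that matrices sharing them can be added and multiplied.\<close>
definition diag_similar :: "nat \<Rightarrow> 'a :: field mat \<Rightarrow> 'a mat \<Rightarrow> 'a mat \<Rightarrow> (nat \<Rightarrow> 'a) \<Rightarrow> bool" where
  "diag_similar n P Q X d \<longleftrightarrow> P \<in> carrier_mat n n \<and> Q \<in> carrier_mat n n \<and> P * Q = 1\<^sub>m n \<and> Q * P = 1\<^sub>m n \<and>
     (\<exists>T \<in> carrier_mat n n. upper_triangular T \<and> X = P * T * Q \<and> (\<forall>i<n. T $$ (i, i) = d i))"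

text \<open>In the sum for the entry \<open>(i, l)\<close> the summand with index \<open>j\<close>
  vanishes unless \<open>i \<le> j \<le> l\<close>. None survives below the diagonal, and only
  \<open>j = i\<close> survives on it.\<close>

lemma upper_triangular_mult:
  fixes S T :: "'a :: field mat"
  assumes S: "S \<in> carrier_mat n n" "upper_triangular S" and T: "T \<in> carrier_mat n n" "upper_triangular T"
  shows "upper_triangular (S * T)" and "i < n \<Longrightarrow> (S * T) $$ (i, i) = S $$ (i, i) * T $$ (i, i)"
proof -
  have zero: "S $$ (i, j) * T $$ (j, l) = 0" if "i < n" "j < n" "j < i \<or> l < j" for i j l
    using that upper_triangularD[OF S(2)] upper_triangularD[OF T(2)] S(1) T(1) by auto
  have entry: "(S * T) $$ (i, l) = (\<Sum>j<n. S $$ (i, j) * T $$ (j, l))" if "i < n" "l < n" for i l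
    using S T that by (simp add: scalar_prod_def atLeast0LessThan)
  show "upper_triangular (S * T)"
  proof
    fix l i assume "l < i" "i < dim_row (S * T)"
    then show "(S * T) $$ (i, l) = 0"
      using S(1) by (subst entry) (auto intro!: sum.neutral zero simp: not_less)
  qed
  show "(S * T) $$ (i, i) = S $$ (i, i) * T $$ (i, i)" if i: "i < n"
  proof -
    have "(\<Sum>j<n. S $$ (i, j) * T $$ (j, i)) = (\<Sum>j\<in>{i}. S $$ (i, j) * T $$ (j, i))"
      using i by (intro sum.mono_neutral_right ballI zero) auto
    then show ?thesis using entry[OF i i] by simp
  qed
qed

lemma diag_similarI:
  assumes "P \<in> carrier_mat n n" "Q \<in> carrier_mat n n" "P * Q = 1\<^sub>m n" "Q * P = 1\<^sub>m n"
    and "T \<in> carrier_mat n n" "upper_triangular T" "X = P * T * Q" "\<And>i. i < n \<Longrightarrow> T $$ (i, i) = d i"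
  shows "diag_similar n P Q X d"
  unfolding diag_similar_def using assms by blast

lemma diag_similar_carrier: "diag_similar n P Q X d \<Longrightarrow> X \<in> carrier_mat n n"
  by (auto simp: diag_similar_def)

lemma diag_similar_one:
  assumes "diag_similar n P Q X d"
  shows "diag_similar n P Q (1\<^sub>m n) (\<lambda>i. 1)"
  using assms by (auto simp: diag_similar_def intro!: bexI[of _ "1\<^sub>m n"])

lemma diag_similar_smult:
  assumes "diag_similar n P Q X d"
  shows "diag_similar n P Q (c \<cdot>\<^sub>m X) (\<lambda>i. c * d i)"
proof -
  from assms obtain T where PQ: "P \<in> carrier_mat n n" "Q \<in> carrier_mat n n" "P * Q = 1\<^sub>m n" "Q * P = 1\<^sub>m n"
    and T: "T \<in> carrier_mat n n" "upper_triangular T" "X = P * T * Q" "\<forall>i<n. T $$ (i, i) = d i"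
    by (auto simp: diag_similar_def)
  have "c \<cdot>\<^sub>m X = P * (c \<cdot>\<^sub>m T) * Q"
    using PQ T by (simp add: mult_smult_distrib[of _ n n _ n] mult_smult_assoc_mat[of _ n n _ n]
        del: assoc_mult_mat)
  moreover have "upper_triangular (c \<cdot>\<^sub>m T)"
    using T by (intro upper_triangularI) (auto dest: upper_triangularD)
  ultimately show ?thesis
    using T by (intro diag_similarI[OF PQ, of "c \<cdot>\<^sub>m T"]) auto
qed

lemma diag_similar_add:
  assumes "diag_similar n P Q X d" "diag_similar n P Q Y e"
  shows "diag_similar n P Q (X + Y) (\<lambda>i. d i + e i)"
proof -
  from assms obtain S T where PQ: "P \<in> carrier_mat n n" "Q \<in> carrier_mat n n" "P * Q = 1\<^sub>m n" "Q * P = 1\<^sub>m n"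
    and S: "S \<in> carrier_mat n n" "upper_triangular S" "X = P * S * Q" "\<forall>i<n. S $$ (i, i) = d i"
    and T: "T \<in> carrier_mat n n" "upper_triangular T" "Y = P * T * Q" "\<forall>i<n. T $$ (i, i) = e i"
    by (auto simp: diag_similar_def)
  have "X + Y = P * (S + T) * Q"
    using PQ S T by (simp add: mult_add_distrib_mat[of _ n n _ n] add_mult_distrib_mat[of _ n n _ _ n]
        del: assoc_mult_mat)
  moreover have "upper_triangular (S + T)"
    using S(1,2) T(1,2) by (intro upper_triangularI) (auto simp: upper_triangularD)
  ultimately show ?thesis
    using S T by (intro diag_similarI[OF PQ, of "S + T"]) auto
qed

lemma diag_similar_minus:
  assumes "diag_similar n P Q X d" "diag_similar n P Q Y e"
  shows "diag_similar n P Q (X - Y) (\<lambda>i. d i - e i)"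
proof -
  have "X - Y = X + (-1) \<cdot>\<^sub>m Y"
    using assms[THEN diag_similar_carrier] by (intro eq_matI) auto
  then show ?thesis
    using diag_similar_add[OF assms(1) diag_similar_smult[OF assms(2), of "-1"]] by simp
qed

lemma diag_similar_mult:
  assumes "diag_similar n P Q X d" "diag_similar n P Q Y e"
  shows "diag_similar n P Q (X * Y) (\<lambda>i. d i * e i)"
proof -
  from assms obtain S T where PQ: "P \<in> carrier_mat n n" "Q \<in> carrier_mat n n" "P * Q = 1\<^sub>m n" "Q * P = 1\<^sub>m n"
    and S: "S \<in> carrier_mat n n" "upper_triangular S" "X = P * S * Q" "\<forall>i<n. S $$ (i, i) = d i"
    and T: "T \<in> carrier_mat n n" "upper_triangular T" "Y = P * T * Q" "\<forall>i<n. T $$ (i, i) = e i"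
    by (auto simp: diag_similar_def)
  have "X * Y = P * S * (Q * P) * T * Q"
    unfolding S(3) T(3) using PQ(1,2) S(1) T(1) by (simp add: assoc_mult_mat[of _ n n _ n _ n])
  then have "X * Y = P * (S * T) * Q"
    using PQ S(1) T(1) by (simp add: assoc_mult_mat[of _ n n _ n _ n])
  then show ?thesis
    using S(1,4) T(1,4) upper_triangular_mult[OF S(1,2) T(1,2)]
    by (intro diag_similarI[OF PQ, of "S * T"]) (simp_all del: assoc_mult_mat index_mult_mat(1))
qed

lemma diag_similar_det:
  assumes "diag_similar n P Q X d"
  shows "det X = (\<Prod>i<n. d i)"
proof -
  from assms obtain T where PQ: "P \<in> carrier_mat n n" "Q \<in> carrier_mat n n" "P * Q = 1\<^sub>m n" "Q * P = 1\<^sub>m n"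
    and T: "T \<in> carrier_mat n n" "upper_triangular T" "X = P * T * Q" "\<forall>i<n. T $$ (i, i) = d i"
    by (auto simp: diag_similar_def)
  have "det X = det P * det T * det Q"
    using PQ T by (simp add: det_mult[of _ n])
  also have "\<dots> = det T * det (P * Q)"
    unfolding det_mult[OF PQ(1,2)] by (simp add: ac_simps)
  also have "\<dots> = prod_list (diag_mat T)"
    using PQ(3) T by (simp add: det_upper_triangular)
  also have "\<dots> = (\<Prod>i<n. T $$ (i, i))"
    using T(1) by (simp add: diag_mat_def prod.list_conv_set_nth atLeast0LessThan)
  finally show ?thesis using T(4) by simp
qed

text \<open>A Schur decomposition puts the listed roots \<open>as\<close> of the characteristic
  polynomial on the diagonal of \<open>T\<close> in their order, so the diagonal carries each
  eigenvalue with its algebraic multiplicity.\<close>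

lemma diag_similar_spectrum:
  fixes A :: "complex mat"
  assumes A: "A \<in> carrier_mat n n"
  obtains P Q d where "diag_similar n P Q A d" "proots (char_poly A) = image_mset d (mset_set {..<n})"
proof -
  obtain as where as: "char_poly A = (\<Prod>a\<leftarrow>as. [:- a, 1:])" "length as = n"
    using char_poly_factorized[OF A] by blast
  obtain T P Q where "schur_decomposition A as = (T, P, Q)"
    by (metis prod_cases3)
  from schur_decomposition[OF A as(1) this]
  have sim: "similar_mat_wit A T P Q" and T: "upper_triangular T" "diag_mat T = as" by auto
  note D = similar_mat_witD2[OF A sim]
  have d: "T $$ (i, i) = as ! i" if "i < n" for i
    using T(2) that D by (auto simp: diag_mat_def)
  have "diag_similar n P Q A (\<lambda>i. as ! i)"
    unfolding diag_similar_def using D T d by auto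
  moreover have "proots (char_poly A) = mset as"
    unfolding as(1)
  proof (induction as)
    case (Cons a as)
    have "(\<Prod>a\<leftarrow>as. [:- a, 1:]) \<noteq> (0 :: complex poly)"
      by (auto simp: prod_list_zero_iff)
    then show ?case
      using Cons.IH by (simp add: proots_mult del: mult_pCons_left)
  qed simp
  moreover have "mset as = image_mset (\<lambda>i. as ! i) (mset_set {..<n})"
    using as(2) by (metis atLeast_upt map_nth mset_map mset_upt atLeast0LessThan)
  ultimately show ?thesis using that by metis
qed

lemma index_mult_mat_sum:
  assumes "A \<in> carrier_mat a b" "B \<in> carrier_mat b c" "i < a" "j < c"
  shows "(A * B) $$ (i, j) = (\<Sum>l<b. A $$ (i, l) * B $$ (l, j))"
  using assms by (simp add: scalar_prod_def atLeast0LessThan)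

lemma sum_nth_distinct:
  assumes "distinct xs"
  shows "(\<Sum>i<length xs. f (xs ! i)) = (\<Sum>x\<in>set xs. f x)"
  using assms by (simp add: sum.distinct_set_conv_list sum_list_sum_nth atLeast0LessThan)

section \<open>Determinants twisted by an involution\<close>

text \<open>As \<open>J\<close> is an involution, \<open>(1 - t J) (1 + t J)\<close> is the scalar
  \<open>c = 1 - t^2\<close>, and \<open>J X = X S\<close> gives
  \<open>(1 - t J) X = X (1 - t S)\<close>. Multiplying by \<open>1 - t J\<close> therefore turns
  \<open>1 + t J - X Y\<close> into \<open>c - X Q\<close> with \<open>Q = (1 - t S) Y\<close>.
  Likewise \<open>1 - t S\<close> turns \<open>1 + t S - Y X\<close> into \<open>c - Q X\<close>,
  and the Weinstein-Aronszajn identity compares the two.\<close>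

lemma det_involution_twist:
  fixes X Y J S :: "'a :: field mat"
  assumes X: "X \<in> carrier_mat N r" and Y: "Y \<in> carrier_mat r N"
    and J: "J \<in> carrier_mat N N" "J * J = 1\<^sub>m N" and S: "S \<in> carrier_mat r r" "S * S = 1\<^sub>m r"
    and JX: "J * X = X * S" and t: "1 - t\<^sup>2 \<noteq> 0"
  shows "det (1\<^sub>m N - t \<cdot>\<^sub>m J) * det (1\<^sub>m N + t \<cdot>\<^sub>m J - X * Y) * (1 - t\<^sup>2) ^ r =
    (1 - t\<^sup>2) ^ N * (det (1\<^sub>m r - t \<cdot>\<^sub>m S) * det (1\<^sub>m r + t \<cdot>\<^sub>m S - Y * X))"
proof -
  have square: "(1\<^sub>m d - t \<cdot>\<^sub>m K) * (1\<^sub>m d + t \<cdot>\<^sub>m K) = (1 - t\<^sup>2) \<cdot>\<^sub>m 1\<^sub>m d"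
    if K: "K \<in> carrier_mat d d" "K * K = 1\<^sub>m d" for K :: "'a mat" and d
  proof -
    have tK: "t \<cdot>\<^sub>m K \<in> carrier_mat d d" "1\<^sub>m d + t \<cdot>\<^sub>m K \<in> carrier_mat d d" using K by auto
    have "(1\<^sub>m d - t \<cdot>\<^sub>m K) * (1\<^sub>m d + t \<cdot>\<^sub>m K) = (1\<^sub>m d + t \<cdot>\<^sub>m K) - (t \<cdot>\<^sub>m K + t \<cdot>\<^sub>m K * (t \<cdot>\<^sub>m K))"
      unfolding minus_mult_distrib_mat[OF one_carrier_mat tK] mult_add_distrib_mat[OF tK(1) one_carrier_mat tK(1)]
        left_mult_one_mat[OF tK(2)] right_mult_one_mat[OF tK(1)] ..
    also have "t \<cdot>\<^sub>m K * (t \<cdot>\<^sub>m K) = (t * t) \<cdot>\<^sub>m 1\<^sub>m d"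
      using K by (simp add: mult_smult_distrib[of _ d d _ d] mult_smult_assoc_mat[of _ d d _ d])
        (auto intro!: eq_matI)
    finally show ?thesis
      using K by (auto intro!: eq_matI simp: power2_eq_square)
  qed
  define Q where "Q = (1\<^sub>m r - t \<cdot>\<^sub>m S) * Y"
  have mS: "1\<^sub>m r - t \<cdot>\<^sub>m S \<in> carrier_mat r r" and pS: "1\<^sub>m r + t \<cdot>\<^sub>m S \<in> carrier_mat r r"
    and mJ: "1\<^sub>m N - t \<cdot>\<^sub>m J \<in> carrier_mat N N" and pJ: "1\<^sub>m N + t \<cdot>\<^sub>m J \<in> carrier_mat N N"
    using S J by (auto simp: minus_carrier_mat)
  have XY: "X * Y \<in> carrier_mat N N" and YX: "Y * X \<in> carrier_mat r r" using X Y by auto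
  have Q: "Q \<in> carrier_mat r N" unfolding Q_def using mS Y by auto
  have "(1\<^sub>m N - t \<cdot>\<^sub>m J) * X = X * (1\<^sub>m r - t \<cdot>\<^sub>m S)"
    using X J S JX
    by (simp add: minus_mult_distrib_mat[of _ N N] mult_minus_distrib_mat[of _ N r _ r]
        mult_smult_distrib[of _ N r _ r] mult_smult_assoc_mat[of _ N N _ r])
  then have "(1\<^sub>m N - t \<cdot>\<^sub>m J) * (X * Y) = X * Q"
    unfolding Q_def assoc_mult_mat[OF mJ X Y, symmetric] assoc_mult_mat[OF X mS Y, symmetric] by simp
  then have left: "(1\<^sub>m N - t \<cdot>\<^sub>m J) * (1\<^sub>m N + t \<cdot>\<^sub>m J - X * Y) = (1 - t\<^sup>2) \<cdot>\<^sub>m 1\<^sub>m N - X * Q"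
    using mult_minus_distrib_mat[OF mJ pJ XY] square[OF J] by simp
  have "(1\<^sub>m r - t \<cdot>\<^sub>m S) * (Y * X) = Q * X"
    unfolding Q_def by (rule assoc_mult_mat[OF mS Y X, symmetric])
  then have right: "(1\<^sub>m r - t \<cdot>\<^sub>m S) * (1\<^sub>m r + t \<cdot>\<^sub>m S - Y * X) = (1 - t\<^sup>2) \<cdot>\<^sub>m 1\<^sub>m r - Q * X"
    using mult_minus_distrib_mat[OF mS pS YX] square[OF S] by simp
  show ?thesis
    using det_weinstein_aronszajn[OF X Q t] unfolding left[symmetric] right[symmetric]
    by (simp only: det_mult[OF mJ minus_carrier_mat[OF XY]] det_mult[OF mS minus_carrier_mat[OF YX]])
qed

text \<open>The matrix is \<open>1 - t S\<close> for the involution \<open>S\<close> that exchanges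
  two blocks of size \<open>n\<close>. Its blocks are scalar, so the block determinant formula
  applies.\<close>

lemma det_one_minus_swap:
  fixes t :: "'a :: field"
  shows "det (four_block_mat (1\<^sub>m n) (- t \<cdot>\<^sub>m 1\<^sub>m n) (- t \<cdot>\<^sub>m 1\<^sub>m n) (1\<^sub>m n)) = (1 - t\<^sup>2) ^ n"
proof -
  have "1\<^sub>m n * 1\<^sub>m n - (- t \<cdot>\<^sub>m 1\<^sub>m n) * (- t \<cdot>\<^sub>m 1\<^sub>m n) = (1 - t\<^sup>2) \<cdot>\<^sub>m 1\<^sub>m n"
    by (auto intro!: eq_matI simp: mult_smult_assoc_mat[of _ n n _ n] power2_eq_square)
  then show ?thesis
    by (simp add: det_four_block_mat[of _ n])
qed

lemma commute_one_plus_smult: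
  fixes A C :: "'a :: field mat"
  assumes "C \<in> carrier_mat n n" "A \<in> carrier_mat n n" "C * A = A * C"
  shows "C * (1\<^sub>m n + d \<cdot>\<^sub>m A) = (1\<^sub>m n + d \<cdot>\<^sub>m A) * C"
  using assms by (simp add: add_mult_distrib_mat[of _ n n] mult_add_distrib_mat[of _ n n _ n]
      mult_smult_distrib[of _ n n _ n] mult_smult_assoc_mat[of _ n n _ n])

text \<open>The lower blocks are polynomials in \<open>A\<close> and commute, so the determinant is
  that of \<open>?A * ?D - ?B * ?C\<close>. This is again a polynomial in \<open>A\<close>,
  triangular in the same basis as \<open>A\<close>, with its values at the eigenvalues on the
  diagonal. The shape of the blocks is the one in \<open>vertex_blocks\<close>.\<close>

lemma det_commuting_blocks:
  fixes A :: "complex mat"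
  assumes A: "A \<in> carrier_mat n n"
  shows "det (four_block_mat
      (1\<^sub>m n + a1 \<cdot>\<^sub>m A + a3 \<cdot>\<^sub>m (A * A * A)) (b0 \<cdot>\<^sub>m 1\<^sub>m n + b2 \<cdot>\<^sub>m (A * A))
      (c0 \<cdot>\<^sub>m 1\<^sub>m n + c2 \<cdot>\<^sub>m (A * A)) (1\<^sub>m n + d1 \<cdot>\<^sub>m A)) =
    (\<Prod>l\<in>#proots (char_poly A).
      (1 + a1 * l + a3 * (l * l * l)) * (1 + d1 * l) - (b0 + b2 * (l * l)) * (c0 + c2 * (l * l)))"
proof -
  let ?B = "b0 \<cdot>\<^sub>m 1\<^sub>m n + b2 \<cdot>\<^sub>m (A * A)"
  let ?C = "c0 \<cdot>\<^sub>m 1\<^sub>m n + c2 \<cdot>\<^sub>m (A * A)"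
  let ?D = "1\<^sub>m n + d1 \<cdot>\<^sub>m A"
  let ?A = "1\<^sub>m n + a1 \<cdot>\<^sub>m A + a3 \<cdot>\<^sub>m (A * A * A)"
  have AA: "A * A \<in> carrier_mat n n" using A by simp
  have C: "?C \<in> carrier_mat n n" and D: "?D \<in> carrier_mat n n" using A by auto
  have "?C * A = A * ?C"
    using A AA by (simp add: add_mult_distrib_mat[of _ n n] mult_add_distrib_mat[of _ n n _ n]
        mult_smult_distrib[of _ n n _ n] mult_smult_assoc_mat[of _ n n _ n])
  from commute_one_plus_smult[OF C A this] have commute: "?C * ?D = ?D * ?C" .
  obtain P Q d where d: "diag_similar n P Q A d" "proots (char_poly A) = image_mset d (mset_set {..<n})"
    using diag_similar_spectrum[OF A] by blast
  note intros = diag_similar_add diag_similar_minus diag_similar_mult diag_similar_smult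
    diag_similar_one[OF d(1)] d(1)
  have "diag_similar n P Q (?A * ?D - ?B * ?C) (\<lambda>i.
      (1 + a1 * d i + a3 * (d i * d i * d i)) * (1 + d1 * d i)
      - (b0 * 1 + b2 * (d i * d i)) * (c0 * 1 + c2 * (d i * d i)))"
    by (intro intros)
  from diag_similar_det[OF this] show ?thesis
    using A AA by (subst det_four_block_mat[of _ n, OF _ _ _ _ commute])
      (simp_all add: d(2) image_mset.compositionality comp_def prod_unfold_prod_mset)
qed

section \<open>Regular graphs without short cycles\<close>

text \<open>This count and the next are the entries of the adjacency matrix and of its square,
  indexed by vertices so that no enumeration is involved.\<close>

definition arc_count :: "('v, 'e) pre_digraph \<Rightarrow> 'v \<Rightarrow> 'v \<Rightarrow> nat" where
  "arc_count G v w = card {e \<in> arcs G. tail G e = v \<and> head G e = w}"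

definition walk2_count :: "('v, 'e) pre_digraph \<Rightarrow> 'v \<Rightarrow> 'v \<Rightarrow> nat" where
  "walk2_count G v w = (\<Sum>z\<in>verts G. arc_count G v z * arc_count G z w)"

text \<open>Without loops exactly one of the two arcs of an edge at \<open>v\<close> has tail
  \<open>v\<close>, so arcs leaving \<open>v\<close> correspond to edges at
  \<open>v\<close>.\<close>

lemma (in bidirected_digraph) deg_eq_out_degree:
  assumes no_loop: "\<And>e. e \<in> arcs G \<Longrightarrow> tail G e \<noteq> head G e"
  shows "deg G arev v = card {e \<in> arcs G. tail G e = v}"
proof -
  have "bij_betw (\<lambda>e. {e, arev e}) {e \<in> arcs G. tail G e = v} {E \<in> uedges G arev. \<exists>e\<in>E. tail G e = v}"
  proof (rule bij_betw_imageI)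
    show "inj_on (\<lambda>e. {e, arev e}) {e \<in> arcs G. tail G e = v}"
      by (rule inj_onI) (use no_loop tail_arev in \<open>fastforce simp: doubleton_eq_iff\<close>)
    show "(\<lambda>e. {e, arev e}) ` {e \<in> arcs G. tail G e = v} = {E \<in> uedges G arev. \<exists>e\<in>E. tail G e = v}"
    proof safe
      fix E f assume E: "E \<in> uedges G arev" "f \<in> E" "v = tail G f"
      then have "E = {f, arev f}" "f \<in> arcs G"
        by (auto simp: uedges_def)
      then show "E \<in> (\<lambda>e. {e, arev e}) ` {e \<in> arcs G. tail G e = tail G f}" by blast
    qed (auto simp: uedges_def)
  qed
  then show ?thesis
    by (simp add: deg_def bij_betw_same_card)
qed

text \<open>The graph-theoretic input in the form in which it is applied: degrees as numbers of
  outgoing arcs, and the absence of loops, of parallel arcs and of two different paths of length two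
  between distinct vertices.\<close>

locale c4_free_regular_graph = fin_digraph G + bidirected_digraph G arev
  for G :: "('v, 'e) pre_digraph" and arev :: "'e \<Rightarrow> 'e" +
  fixes k :: nat
  assumes out_degree_eq: "v \<in> verts G \<Longrightarrow> card {e \<in> arcs G. tail G e = v} = k"
    and k_gt_2: "k > 2"
    and no_loop: "e \<in> arcs G \<Longrightarrow> tail G e \<noteq> head G e"
    and arc_eqI: "\<lbrakk>e \<in> arcs G; f \<in> arcs G; tail G e = tail G f; head G e = head G f\<rbrakk> \<Longrightarrow> e = f"
    and common_neighbour_unique:
      "\<lbrakk>e \<in> arcs G; f \<in> arcs G; e' \<in> arcs G; f' \<in> arcs G; tail G e = tail G e'; head G e = tail G f;
        head G e' = tail G f'; head G f = head G f'; tail G e \<noteq> head G f\<rbrakk> \<Longrightarrow> head G e = head G e'"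
begin

lemma in_degree_eq:
  assumes "v \<in> verts G"
  shows "card {e \<in> arcs G. head G e = v} = k"
proof -
  have "bij_betw arev {e \<in> arcs G. head G e = v} {e \<in> arcs G. tail G e = v}"
    by (rule bij_betwI[where g = arev]) auto
  then show ?thesis using out_degree_eq[OF assms] by (simp add: bij_betw_same_card)
qed

lemma arc_count_sym: "arc_count G v w = arc_count G w v"
  unfolding arc_count_def
  by (intro bij_betw_same_card[of arev] bij_betwI[where g = arev]) auto

lemma sum_out_arcs:
  fixes f :: "'v \<Rightarrow> 'a :: comm_semiring_1"
  shows "(\<Sum>e | e \<in> arcs G \<and> tail G e = v. f (head G e)) = (\<Sum>w\<in>verts G. of_nat (arc_count G v w) * f w)"
proof -
  have "(\<Sum>e | e \<in> arcs G \<and> tail G e = v. f (head G e)) =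
      (\<Sum>w\<in>verts G. \<Sum>e | e \<in> {e \<in> arcs G. tail G e = v} \<and> head G e = w. f (head G e))"
    by (subst sum.group) auto
  also have "\<dots> = (\<Sum>w\<in>verts G. of_nat (arc_count G v w) * f w)"
    by (intro sum.cong) (auto simp: arc_count_def conj_assoc)
  finally show ?thesis .
qed

lemma sum_in_arcs:
  fixes f :: "'v \<Rightarrow> 'a :: comm_semiring_1"
  shows "(\<Sum>e | e \<in> arcs G \<and> head G e = v. f (tail G e)) = (\<Sum>w\<in>verts G. of_nat (arc_count G v w) * f w)"
proof -
  have "(\<Sum>e | e \<in> arcs G \<and> head G e = v. f (tail G e)) =
      (\<Sum>e | e \<in> arcs G \<and> tail G e = v. f (head G e))"
    by (rule sum.reindex_bij_witness[of _ arev arev]) auto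
  then show ?thesis by (simp add: sum_out_arcs)
qed

lemma walk2_count_sym: "walk2_count G v w = walk2_count G w v"
  unfolding walk2_count_def by (intro sum.cong) (simp_all add: arc_count_sym mult.commute)

lemma walk2_count_eq_sum_in:
  "(\<Sum>e | e \<in> arcs G \<and> head G e = w. of_nat (arc_count G v (tail G e))) =
    (of_nat (walk2_count G v w) :: 'a :: comm_semiring_1)"
  unfolding sum_in_arcs[where f = "\<lambda>z. of_nat (arc_count G v z)"] walk2_count_def
  by (simp add: arc_count_sym[of w] mult.commute)

lemma arc_count_le_1: "arc_count G v w \<le> 1"
  unfolding arc_count_def One_nat_def
  by (subst card_le_Suc0_iff_eq) (use arc_eqI in auto)

lemma arc_count_arc: "e \<in> arcs G \<Longrightarrow> arc_count G (tail G e) (head G e) = 1"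
proof -
  assume "e \<in> arcs G"
  then have "{f \<in> arcs G. tail G f = tail G e \<and> head G f = head G e} = {e}"
    using arc_eqI by blast
  then show ?thesis by (simp add: arc_count_def)
qed

lemma arc_count_nonzeroE:
  assumes "arc_count G v w \<noteq> 0"
  obtains e where "e \<in> arcs G" "tail G e = v" "head G e = w"
  using assms by (auto simp: arc_count_def card_eq_0_iff)

text \<open>There is at most one arc between two given vertices in a given direction, so a walk of
  length two from \<open>v\<close> to \<open>w\<close> is determined by its first arc.\<close>

lemma walk2_count_eq_card:
  "walk2_count G v w = card {e \<in> arcs G. tail G e = v \<and> arc_count G (head G e) w = 1}"
proof -
  have "walk2_count G v w = (\<Sum>e | e \<in> arcs G \<and> tail G e = v. arc_count G (head G e) w)"
    using sum_out_arcs[where f = "\<lambda>z. arc_count G z w"] by (simp add: walk2_count_def)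
  also have "\<dots> = (\<Sum>e | e \<in> arcs G \<and> tail G e = v. of_bool (arc_count G (head G e) w = 1))"
    by (intro sum.cong refl) (use arc_count_le_1 in \<open>auto simp: le_Suc_eq\<close>)
  also have "\<dots> = card ({e \<in> arcs G. tail G e = v} \<inter> {e. arc_count G (head G e) w = 1})"
    by (simp add: sum_of_bool_eq)
  finally show ?thesis by (simp add: Collect_conj_eq Int_ac)
qed

lemma walk2_count_self: "v \<in> verts G \<Longrightarrow> walk2_count G v v = k"
proof -
  assume v: "v \<in> verts G"
  have "{e \<in> arcs G. tail G e = v \<and> arc_count G (head G e) v = 1} = {e \<in> arcs G. tail G e = v}"
    using arc_count_arc arc_count_sym by auto
  then show ?thesis using out_degree_eq[OF v] by (simp add: walk2_count_eq_card)
qed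

lemma walk2_count_le_1:
  assumes "v \<noteq> w"
  shows "walk2_count G v w \<le> 1"
proof -
  have "e = e'" if "e \<in> arcs G" "tail G e = v" "arc_count G (head G e) w = 1"
    "e' \<in> arcs G" "tail G e' = v" "arc_count G (head G e') w = 1" for e e'
  proof -
    from that(3) obtain f where f: "f \<in> arcs G" "tail G f = head G e" "head G f = w"
      using arc_count_nonzeroE[of "head G e" w] by auto
    from that(6) obtain f' where f': "f' \<in> arcs G" "tail G f' = head G e'" "head G f' = w"
      using arc_count_nonzeroE[of "head G e'" w] by auto
    have "head G e = head G e'"
      by (rule common_neighbour_unique[of e f e' f']) (use that f f' assms in auto)
    then show ?thesis using that arc_eqI by metis
  qed
  then show ?thesis
    unfolding walk2_count_eq_card by (simp add: card_le_Suc0_iff_eq)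
qed

lemma walk2_count_pos:
  assumes "e \<in> arcs G" "f \<in> arcs G" "head G e = tail G f"
  shows "walk2_count G (tail G e) (head G f) \<ge> 1"
proof -
  have "e \<in> {e' \<in> arcs G. tail G e' = tail G e \<and> arc_count G (head G e') (head G f) = 1}"
    using assms arc_count_arc[of f] by auto
  then show ?thesis
    unfolding walk2_count_eq_card by (metis (no_types, lifting) One_nat_def Suc_leI card_gt_0_iff empty_iff finite_arcs finite_subset mem_Collect_eq subsetI)
qed

section \<open>Entries of the cubed Grover matrix and their signs\<close>

text \<open>The expansion of \<open>(P S H\<^sup>t - J)\<^sup>3\<close>. The multiples of
  \<open>S H\<^sup>t\<close>, namely \<open>- k P\<^sup>2 + 2 P\<close>, cancel because
  \<open>P = 2 / k\<close>.\<close>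

definition grover_cube_entry :: "'e \<Rightarrow> 'e \<Rightarrow> real" where
  "grover_cube_entry e g = (2 / k)^3 * walk2_count G (tail G e) (head G g)
     - (2 / k)^2 * (arc_count G (tail G e) (tail G g) + arc_count G (head G e) (head G g))
     + (2 / k) * of_bool (head G e = tail G g) - of_bool (g = arev e)"

text \<open>The entry of \<open>T\<^sup>3 + T\<^sup>t\<close>; its summands are grouped as in \<open>X Y - 2 J\<close>.\<close>
definition cube_support_entry :: "'e \<Rightarrow> 'e \<Rightarrow> int" where
  "cube_support_entry e g =
     (int (walk2_count G (tail G e) (head G g)) + (2 - int k) * of_bool (tail G e = head G g)
        - int (arc_count G (tail G e) (tail G g)))
     + (2 * of_bool (head G e = tail G g) - int (arc_count G (head G e) (head G g)))
     - 2 * of_bool (g = arev e)"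

text \<open>The cases ask whether \<open>g\<close> ends where \<open>e\<close> starts and whether
  \<open>g\<close> starts where \<open>e\<close> ends. The signs rest on \<open>P^3 < P^2\<close>,
  by which one adjacency outweighs a single walk of length two, and on \<open>k P^3 = 2 P^2\<close>,
  by which the \<open>k\<close> closed walks at a vertex balance exactly two adjacencies.\<close>

lemma cube_support:
  assumes e: "e \<in> arcs G" and g: "g \<in> arcs G"
  shows "(if grover_cube_entry e g > 0 then 1 else 0) = cube_support_entry e g"
proof -
  let ?c = "walk2_count G (tail G e) (head G g)"
  let ?y = "arc_count G (tail G e) (tail G g)"
  let ?x = "arc_count G (head G e) (head G g)"
  define P :: real where "P = 2 / k"
  have P: "0 < P" "P < 1" using k_gt_2 by (auto simp: P_def)
  have P3: "P ^ 3 < P ^ 2" using P by (simp add: power_strict_decreasing)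
  have Pk: "P ^ 3 * real k = 2 * P ^ 2" using k_gt_2 by (simp add: P_def power3_eq_cube power2_eq_square)
  have U: "grover_cube_entry e g = P ^ 3 * real ?c - P ^ 2 * (real ?y + real ?x)
      + P * of_bool (head G e = tail G g) - of_bool (g = arev e)"
    by (simp add: grover_cube_entry_def P_def)
  have verts: "tail G e \<in> verts G" using e by auto
  have rev: "g = arev e \<longleftrightarrow> tail G e = head G g \<and> head G e = tail G g"
    using e g arc_eqI[of g "arev e"] by auto
  consider (both) "tail G e = head G g" "head G e = tail G g"
    | (left) "tail G e = head G g" "head G e \<noteq> tail G g"
    | (right) "tail G e \<noteq> head G g" "head G e = tail G g"
    | (neither) "tail G e \<noteq> head G g" "head G e \<noteq> tail G g" by blast
  then show ?thesis
  proof cases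
    case both
    then have yxc: "?y = 1" "?x = 1" "?c = k" and r: "(g = arev e) = True"
      using arc_count_arc[OF e] arc_count_arc[OF g] arc_count_sym walk2_count_self[OF verts] rev
      by (metis, metis, metis, metis)
    show ?thesis
      unfolding U cube_support_entry_def yxc r using both P Pk by simp
  next
    case left
    then have yxc: "?y = 1" "?x = 1" "?c = k" and r: "(g = arev e) = False"
      using arc_count_arc[OF e] arc_count_arc[OF g] arc_count_sym walk2_count_self[OF verts] rev
      by (metis, metis, metis, metis)
    \<comment> \<open>The entry is exactly zero here, hence not in the positive support.\<close>
    have "P ^ 3 * real k - P ^ 2 * (real 1 + real 1) = 0" using Pk by simp
    then have "grover_cube_entry e g = 0"
      unfolding U yxc r using left by simp
    moreover have "cube_support_entry e g = 0"
      unfolding cube_support_entry_def yxc r using left by simp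
    ultimately show ?thesis by simp
  next
    case right
    then have "?y = 1" "?x = 1"
      using arc_count_arc[OF e] arc_count_arc[OF g] arc_count_sym by (metis, metis)
    moreover have "?c = 1"
      using walk2_count_pos[OF e g right(2)] walk2_count_le_1[OF right(1)] by simp
    \<comment> \<open>The left side is the entry for \<open>?c = ?x = ?y = 1\<close>; it is strictly
      positive because \<open>k > 2\<close> makes \<open>P < 1\<close>.\<close>
    moreover have "P ^ 3 - 2 * P ^ 2 + P = P * (1 - P) ^ 2"
      by (simp add: power2_eq_square power3_eq_cube algebra_simps)
    moreover have "P * (1 - P) ^ 2 > 0" using P by simp
    ultimately show ?thesis
      using right rev by (simp add: U cube_support_entry_def)
  next
    case neither
    have c: "?c \<le> 1" using walk2_count_le_1[OF neither(1)] .
    have x: "?x \<le> 1" "?x \<noteq> 0 \<Longrightarrow> ?c = 1"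
    proof -
      assume "?x \<noteq> 0"
      then obtain f where "f \<in> arcs G" "tail G f = head G e" "head G f = head G g"
        by (rule arc_count_nonzeroE)
      then show "?c = 1" using walk2_count_pos[OF e, of f] c by simp
    qed (rule arc_count_le_1)
    have y: "?y \<le> 1" "?y \<noteq> 0 \<Longrightarrow> ?c = 1"
    proof -
      assume "?y \<noteq> 0"
      then obtain f where "f \<in> arcs G" "tail G f = tail G e" "head G f = tail G g"
        by (rule arc_count_nonzeroE)
      then show "?c = 1" using walk2_count_pos[OF _ g, of f] c by simp
    qed (rule arc_count_le_1)
    \<comment> \<open>If both were nonzero, \<open>tail G e\<close>, \<open>head G e\<close>,
      \<open>head G g\<close>, \<open>tail G g\<close> would form a cycle of length four.\<close>
    have xy: "?x = 0 \<or> ?y = 0"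
    proof (rule ccontr)
      assume "\<not> ?thesis"
      then obtain f f' where "f \<in> arcs G" "tail G f = head G e" "head G f = head G g"
        "f' \<in> arcs G" "tail G f' = tail G e" "head G f' = tail G g"
        using arc_count_nonzeroE[of "head G e" "head G g"] arc_count_nonzeroE[of "tail G e" "tail G g"]
        by metis
      then have "head G e = head G f'"
        using neither e g by (intro common_neighbour_unique[of e f f' g]) auto
      then show False using neither \<open>head G f' = tail G g\<close> by simp
    qed
    \<comment> \<open>An adjacency counted by \<open>?x\<close> or \<open>?y\<close> extends
      \<open>e\<close> or \<open>g\<close> to a walk of length two, so it forces
      \<open>?c = 1\<close>. Of the four remaining triples only the second gives a positive
      entry.\<close>
    have "?c = 0 \<and> ?x = 0 \<and> ?y = 0 \<or> ?c = 1 \<and> ?x = 0 \<and> ?y = 0 \<or>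
        ?c = 1 \<and> ?x = 1 \<and> ?y = 0 \<or> ?c = 1 \<and> ?x = 0 \<and> ?y = 1"
      using c x y xy by linarith
    moreover obtain a b where ab: "P ^ 3 = a" "P ^ 2 = b" by blast
    moreover have "grover_cube_entry e g = a * real ?c - b * (real ?y + real ?x)"
      unfolding U ab using neither rev by simp
    moreover have "cube_support_entry e g = int ?c - int ?y - int ?x"
      unfolding cube_support_entry_def using neither rev by simp
    moreover have "0 < a" "a < b" using ab P P3 by auto
    ultimately show ?thesis by auto
  qed
qed

text \<open>The case \<open>f = arev e\<close> also satisfies \<open>head G f = tail G e\<close>, so
  the case distinction collapses to the entry of \<open>P S H\<^sup>t - J\<close>.\<close>

lemma grover_entry_eq:
  assumes "e \<in> arcs G" "f \<in> arcs G"
  shows "grover_entry G arev e f = (2 / k) * of_bool (head G f = tail G e) - of_bool (f = arev e)"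
  using assms deg_eq_out_degree no_loop out_degree_eq by (simp add: grover_entry_def)

lemma sum_mult_of_bool:
  fixes c :: real
  assumes "finite A"
  shows "(\<Sum>x\<in>A. c * of_bool (Q x)) = c * card (A \<inter> {x. Q x})"
  using assms by (simp add: sum_distrib_left[symmetric] sum_of_bool_eq)

lemma grover_sum:
  assumes e: "e \<in> arcs G"
  shows "(\<Sum>f\<in>arcs G. grover_entry G arev e f * x f) =
    (2 / k) * (\<Sum>f | f \<in> arcs G \<and> head G f = tail G e. x f) - x (arev e)"
proof -
  have "(\<Sum>f\<in>arcs G. grover_entry G arev e f * x f) =
      (\<Sum>f\<in>arcs G. (2 / k) * (if head G f = tail G e then x f else 0) - (if f = arev e then x f else 0))"
    using e by (intro sum.cong refl) (auto simp: grover_entry_eq algebra_simps)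
  also have "\<dots> = (2 / k) * (\<Sum>f\<in>arcs G. if head G f = tail G e then x f else 0) - x (arev e)"
    using e by (simp add: sum_subtractf sum_distrib_left)
  finally show ?thesis by (simp add: sum.inter_filter)
qed

text \<open>Entrywise form of \<open>U\<^sup>2 = P\<^sup>2 S A H\<^sup>t - P S S\<^sup>t - P H
  H\<^sup>t + I\<close>.\<close>

lemma grover_square:
  assumes e: "e \<in> arcs G" and g: "g \<in> arcs G"
  shows "(\<Sum>f\<in>arcs G. grover_entry G arev e f * grover_entry G arev f g) =
    (2 / k)^2 * arc_count G (head G g) (tail G e) - (2 / k) * of_bool (tail G e = tail G g)
     - (2 / k) * of_bool (head G e = head G g) + of_bool (g = e)"
proof -
  let ?I = "{f \<in> arcs G. head G f = tail G e}"
  have "(\<Sum>f\<in>?I. grover_entry G arev f g) =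
      (\<Sum>f\<in>?I. (2 / k) * of_bool (tail G f = head G g) - of_bool (f = arev g))"
    using g by (intro sum.cong refl) (auto simp: grover_entry_eq)
  also have "\<dots> = (2 / k) * card (?I \<inter> {f. tail G f = head G g}) - card (?I \<inter> {f. f = arev g})"
    unfolding sum_subtractf by (subst sum_mult_of_bool) (auto simp: sum_of_bool_eq)
  also have "?I \<inter> {f. tail G f = head G g} = {f \<in> arcs G. tail G f = head G g \<and> head G f = tail G e}"
    by auto
  also have "card (?I \<inter> {f. f = arev g}) = of_bool (tail G e = tail G g)"
  proof -
    have "?I \<inter> {f. f = arev g} = (if tail G e = tail G g then {arev g} else {})" using g by auto
    then show ?thesis by simp
  qed
  finally have 1: "(\<Sum>f\<in>?I. grover_entry G arev f g) =
      (2 / k) * arc_count G (head G g) (tail G e) - of_bool (tail G e = tail G g)"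
    by (simp add: arc_count_def)
  have 2: "grover_entry G arev (arev e) g = (2 / k) * of_bool (head G e = head G g) - of_bool (g = e)"
    using e g by (subst grover_entry_eq) (auto simp: eq_commute)
  show ?thesis
    unfolding grover_sum[OF e] 1 2 by (simp add: algebra_simps power2_eq_square)
qed

lemma grover_cube:
  assumes e: "e \<in> arcs G" and g: "g \<in> arcs G"
  shows "(\<Sum>f\<in>arcs G. grover_entry G arev e f *
      (\<Sum>f'\<in>arcs G. grover_entry G arev f f' * grover_entry G arev f' g)) = grover_cube_entry e g"
proof -
  let ?I = "{f \<in> arcs G. head G f = tail G e}"
  have tail: "tail G e \<in> verts G" using e by auto
  have "(\<Sum>f\<in>?I. \<Sum>f'\<in>arcs G. grover_entry G arev f f' * grover_entry G arev f' g) =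
      (\<Sum>f\<in>?I. (2 / k)^2 * arc_count G (head G g) (tail G f) - (2 / k) * of_bool (tail G f = tail G g)
         - (2 / k) * of_bool (tail G e = head G g) + of_bool (f = g))"
    using g by (intro sum.cong refl) (auto simp: grover_square)
  also have "\<dots> = (2 / k)^2 * (\<Sum>f\<in>?I. arc_count G (head G g) (tail G f))
      - (2 / k) * card (?I \<inter> {f. tail G f = tail G g})
      - card ?I * ((2 / k) * of_bool (tail G e = head G g)) + card (?I \<inter> {f. f = g})"
    by (simp add: sum_subtractf sum.distrib sum_mult_of_bool sum_of_bool_eq sum_distrib_left[symmetric]
        del: times_divide_eq_left)
  also have "?I \<inter> {f. tail G f = tail G g} = {f \<in> arcs G. tail G f = tail G g \<and> head G f = tail G e}"
    by auto
  also have "card (?I \<inter> {f. f = g}) = of_bool (tail G e = head G g)"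
  proof -
    have "?I \<inter> {f. f = g} = (if tail G e = head G g then {g} else {})" using g by auto
    then show ?thesis by simp
  qed
  also have "card ?I = k" by (rule in_degree_eq[OF tail])
  also have "(\<Sum>f\<in>?I. arc_count G (head G g) (tail G f)) = walk2_count G (tail G e) (head G g)"
    by (subst walk2_count_sym)
      (use walk2_count_eq_sum_in[where 'a = nat and w = "tail G e" and v = "head G g"] in simp)
  also have "card {f \<in> arcs G. tail G f = tail G g \<and> head G f = tail G e} = arc_count G (tail G e) (tail G g)"
    by (subst arc_count_sym) (simp add: arc_count_def)
  finally have 1: "(\<Sum>f\<in>?I. \<Sum>f'\<in>arcs G. grover_entry G arev f f' * grover_entry G arev f' g) =
      (2 / k)^2 * walk2_count G (tail G e) (head G g) - (2 / k) * arc_count G (tail G e) (tail G g)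
      - of_bool (tail G e = head G g)"
    using k_gt_2 by simp
  have 2: "(\<Sum>f'\<in>arcs G. grover_entry G arev (arev e) f' * grover_entry G arev f' g) =
      (2 / k)^2 * arc_count G (head G e) (head G g) - (2 / k) * of_bool (head G e = tail G g)
     - (2 / k) * of_bool (tail G e = head G g) + of_bool (g = arev e)"
    using e g by (simp add: grover_square arc_count_sym[of "head G g" "head G e"])
  \<comment> \<open>The term in \<open>of_bool (tail G e = head G g)\<close> from \<open>1\<close>,
    scaled by \<open>2 / k\<close>, cancels against the one from \<open>2\<close>, which is
    subtracted.\<close>
  show ?thesis
    unfolding grover_sum[OF e] 1 2 grover_cube_entry_def
    by (simp add: algebra_simps power2_eq_square power3_eq_cube)
qed

end

text \<open>A violation of each exclusion yields an essential cycle of length at most four: a loop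
  run through twice in the same direction, since a cycle needs length at least 2; one parallel arc
  followed by the reverse of the other; or one path of length two followed by the reverse of the
  other.\<close>

lemma c4_free_regular_graphI:
  assumes "fin_digraph G" "bidirected_digraph G arev" "regular G arev k" "k > 2" "girth G arev > 4"
  shows "c4_free_regular_graph G arev k"
proof -
  interpret fin_digraph G by fact
  interpret bidirected_digraph G arev by fact
  have no_cycle: "\<not> essential_cycle G arev p" if "length p \<le> 4" for p
  proof
    assume "essential_cycle G arev p"
    then have "girth G arev \<le> enat (length p)"
      unfolding girth_def by (intro INF_lower) simp
    also have "\<dots> \<le> enat 4" using that by simp
    finally show False using assms(5) by (simp add: numeral_eq_enat)
  qed
  have no_loop: "tail G e \<noteq> head G e" if "e \<in> arcs G" for e
  proof
    assume "tail G e = head G e"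
    then have "essential_cycle G arev [e, e]"
      unfolding essential_cycle_def using that arev_neq
      by (intro exI[of _ "tail G e"]) (auto simp: awalk_def reduced_def less_Suc_eq)
    then show False using no_cycle[of "[e, e]"] by simp
  qed
  have arc_eqI: "e = f"
    if "e \<in> arcs G" "f \<in> arcs G" "tail G e = tail G f" "head G e = head G f" for e f
  proof (rule ccontr)
    assume "e \<noteq> f"
    then have "essential_cycle G arev [e, arev f]"
      unfolding essential_cycle_def using that
      by (intro exI[of _ "tail G e"]) (auto simp: awalk_def reduced_def less_Suc_eq)
    then show False using no_cycle[of "[e, arev f]"] by simp
  qed
  have common: "head G e = head G e'"
    if "e \<in> arcs G" "f \<in> arcs G" "e' \<in> arcs G" "f' \<in> arcs G" "tail G e = tail G e'" "head G e = tail G f"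
      "head G e' = tail G f'" "head G f = head G f'" "tail G e \<noteq> head G f" for e f e' f'
  proof (rule ccontr)
    assume ne: "head G e \<noteq> head G e'"
    let ?p = "[e, f, arev f', arev e']"
    have "pre_digraph.awalk G (tail G e) ?p (tail G e)"
      using that by (auto simp: awalk_def)
    \<comment> \<open>Reducedness at the three junctions of \<open>?p\<close>, in order. The
      vertices that must be distinct are \<open>head G e\<close>, \<open>head G f\<close> and
      \<open>head G e'\<close>.\<close>
    moreover have "arev f \<noteq> e" "f' \<noteq> f" "arev (arev e') \<noteq> arev f'"
      using that ne by auto
    then have "reduced arev ?p"
      by (auto simp: reduced_def less_Suc_eq)
    moreover have "distinct (butlast (tl (pre_digraph.awalk_verts G (tail G e) ?p)))"
      using that ne no_loop[of f] no_loop[of f'] by auto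
    ultimately have "essential_cycle G arev ?p"
      unfolding essential_cycle_def by (intro exI[of _ "tail G e"]) auto
    then show False using no_cycle[of ?p] by simp
  qed
  have out: "card {e \<in> arcs G. tail G e = v} = k" if "v \<in> verts G" for v
    using assms(3) that deg_eq_out_degree[OF no_loop] by (simp add: regular_def)
  show ?thesis
    by unfold_locales (fact out assms(4) no_loop arc_eqI common)+
qed

section \<open>The characteristic determinant\<close>

lemma sum_split: "(\<Sum>j<a + b. f j) = (\<Sum>j<a. f j) + (\<Sum>j<b. f (a + j :: nat))"
  for f :: "nat \<Rightarrow> 'a :: comm_monoid_add"
  by (induction b) (simp_all add: ac_simps)

context c4_free_regular_graph
begin

lemma card_arcs: "card (arcs G) = card (verts G) * k"
proof -
  have "(\<Sum>v\<in>verts G. card {e \<in> arcs G. tail G e = v}) = (\<Sum>v\<in>verts G. k)"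
    by (intro sum.cong) (simp_all add: out_degree_eq)
  moreover have "card (arcs G) = (\<Sum>v\<in>verts G. card {e \<in> arcs G. tail G e = v})"
    by (subst card_eq_sum, subst sum.group[symmetric, of _ "verts G" "tail G"]) auto
  ultimately show ?thesis by simp
qed

lemma uedge_props:
  assumes "E \<in> uedges G arev"
  shows "E \<subseteq> arcs G" "card E = 2" "e \<in> E \<Longrightarrow> E = {e, arev e}"
  using assms arev_neq[THEN not_sym] by (auto simp: uedges_def)

lemma card_arcs_eq_num_edges: "card (arcs G) = 2 * num_edges G arev"
proof -
  have "card (\<Union> (uedges G arev)) = (\<Sum>E\<in>uedges G arev. card E)"
  proof (rule card_Union_disjoint)
    show "pairwise disjnt (uedges G arev)"
      using uedge_props(3) unfolding pairwise_def disjnt_iff by metis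
  qed (auto simp: uedges_def)
  also have "\<dots> = 2 * num_edges G arev"
    by (simp add: uedge_props(2) num_edges_def)
  also have "\<Union> (uedges G arev) = arcs G" by (auto simp: uedges_def)
  finally show ?thesis .
qed

text \<open>From \<open>k n = 2 m\<close> and \<open>k \<ge> 2\<close>. This makes the
  natural-number difference \<open>m - n\<close> a true difference.\<close>

lemma card_verts_le_num_edges: "card (verts G) \<le> num_edges G arev"
proof -
  have "card (verts G) * 2 \<le> card (verts G) * k" using k_gt_2 by (intro mult_le_mono2) simp
  then show ?thesis using card_arcs card_arcs_eq_num_edges by linarith
qed

end

section \<open>Incidence matrices over fixed enumerations\<close>

locale enumerated_c4_free_regular_graph = c4_free_regular_graph G arev k
  for G :: "('v, 'e) pre_digraph" and arev :: "'e \<Rightarrow> 'e" and k :: nat +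
  fixes vs :: "'v list" and es :: "'e list"
  assumes vs: "distinct vs" "set vs = verts G" and es: "distinct es" "set es = arcs G"
begin

abbreviation "n \<equiv> length vs"
abbreviation "N \<equiv> length es"

lemma length_vs: "n = card (verts G)"
  using vs distinct_card by metis

lemma length_es: "N = 2 * num_edges G arev"
  using es distinct_card card_arcs_eq_num_edges by metis

lemma vs_nth [simp]: "i < n \<Longrightarrow> vs ! i \<in> verts G"
  using vs(2) by force

lemma es_nth [simp]: "i < N \<Longrightarrow> es ! i \<in> arcs G"
  using es(2) by force

lemma sum_vs: "(\<Sum>i<n. f (vs ! i)) = (\<Sum>v\<in>verts G. f v)"
  using sum_nth_distinct[OF vs(1)] vs(2) by metis

lemma sum_es: "(\<Sum>i<N. f (es ! i)) = (\<Sum>e\<in>arcs G. f e)"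
  using sum_nth_distinct[OF es(1)] es(2) by metis

lemma grover_mat_cube_index:
  assumes "i < N" "j < N"
  shows "(grover_mat G arev es ^\<^sub>m 3) $$ (i, j) = grover_cube_entry (es ! i) (es ! j)"
proof -
  let ?U = "grover_mat G arev es"
  have U: "?U \<in> carrier_mat N N" by (simp add: grover_mat_def)
  have entry: "?U $$ (i, j) = grover_entry G arev (es ! i) (es ! j)" if "i < N" "j < N" for i j
    using that by (simp add: grover_mat_def)
  have "?U ^\<^sub>m 3 = ?U * (?U * ?U)"
    using U by (simp add: numeral_3_eq_3 assoc_mult_mat[of _ N N _ N _ N])
  also have "\<dots> $$ (i, j) = (\<Sum>l<N. ?U $$ (i, l) * (\<Sum>l'<N. ?U $$ (l, l') * ?U $$ (l', j)))"
    unfolding index_mult_mat_sum[OF U mult_carrier_mat[OF U U] assms]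
    by (intro sum.cong refl arg_cong2[of _ _ _ _ "(*)"] index_mult_mat_sum[OF U U _ assms(2)]) simp
  also have "\<dots> = (\<Sum>l<N. grover_entry G arev (es ! i) (es ! l) *
      (\<Sum>f'\<in>arcs G. grover_entry G arev (es ! l) f' * grover_entry G arev f' (es ! j)))"
    using assms by (intro sum.cong refl) (simp add: entry sum_es[symmetric])
  also have "\<dots> = (\<Sum>f\<in>arcs G. grover_entry G arev (es ! i) f *
      (\<Sum>f'\<in>arcs G. grover_entry G arev f f' * grover_entry G arev f' (es ! j)))"
    by (rule sum_es)
  finally show ?thesis
    using assms by (simp add: grover_cube)
qed

definition support_cube :: "complex mat" where
  "support_cube = map_mat complex_of_real (pos_support (grover_mat G arev es ^\<^sub>m 3))"

definition adj :: "complex mat" where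
  "adj = map_mat complex_of_real (adjacency_mat G vs)"

definition reversal :: "complex mat" where
  "reversal = mat N N (\<lambda>(i, j). of_bool (es ! j = arev (es ! i)))"

text \<open>The matrix \<open>X = [S, H]\<close>: the first \<open>n\<close> columns stand for
  tails, the last \<open>n\<close> for heads.\<close>

definition endpoints :: "complex mat" where
  "endpoints = mat N (n + n) (\<lambda>(i, j).
     of_bool (if j < n then tail G (es ! i) = vs ! j else head G (es ! i) = vs ! (j - n)))"

text \<open>
  The two block rows \<open>(A\<^sup>2 + (2 - k) I) H\<^sup>t - A S\<^sup>t\<close> and \<open>2 S\<^sup>t - A H\<^sup>t\<close> of \<open>Y\<close>, read off from the expansion of
  \<open>T\<^sup>3 + T\<^sup>t + 2 J\<close> by collecting the terms that begin with \<open>S\<close> and with \<open>H\<close>.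
\<close>
definition coendpoint_tail :: "'v \<Rightarrow> 'e \<Rightarrow> complex" where
  "coendpoint_tail v g = of_nat (walk2_count G v (head G g)) + (2 - of_nat k) * of_bool (v = head G g)
     - of_nat (arc_count G v (tail G g))"

definition coendpoint_head :: "'v \<Rightarrow> 'e \<Rightarrow> complex" where
  "coendpoint_head v g = 2 * of_bool (v = tail G g) - of_nat (arc_count G v (head G g))"

definition coendpoints :: "complex mat" where
  "coendpoints = mat (n + n) N (\<lambda>(i, j).
     if i < n then coendpoint_tail (vs ! i) (es ! j) else coendpoint_head (vs ! (i - n)) (es ! j))"

definition swap :: "complex mat" where
  "swap = four_block_mat (0\<^sub>m n n) (1\<^sub>m n) (1\<^sub>m n) (0\<^sub>m n n)"

lemma carriers:
  "support_cube \<in> carrier_mat N N" "adj \<in> carrier_mat n n" "reversal \<in> carrier_mat N N"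
  "endpoints \<in> carrier_mat N (n + n)" "coendpoints \<in> carrier_mat (n + n) N" "swap \<in> carrier_mat (n + n) (n + n)"
  by (auto simp: support_cube_def adj_def reversal_def endpoints_def coendpoints_def swap_def
      pos_support_def grover_mat_def adjacency_mat_def pow_carrier_mat)

lemma sum_delta_vs:
  assumes "v \<in> verts G"
  shows "(\<Sum>j<n. of_bool (v = vs ! j) * f (vs ! j)) = (f v :: complex)"
proof -
  have "(\<Sum>j<n. of_bool (v = vs ! j) * f (vs ! j)) = (\<Sum>w\<in>verts G. of_bool (v = w) * f w)"
    by (rule sum_vs)
  also have "\<dots> = (\<Sum>w\<in>verts G. if v = w then f w else 0)" by (intro sum.cong) auto
  finally show ?thesis using assms by simp
qed

lemma sum_delta_es:
  assumes "e \<in> arcs G"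
  shows "(\<Sum>j<N. of_bool (es ! j = e) * f (es ! j)) = (f e :: complex)"
proof -
  have "(\<Sum>j<N. of_bool (es ! j = e) * f (es ! j)) = (\<Sum>g\<in>arcs G. of_bool (g = e) * f g)"
    by (rule sum_es)
  also have "\<dots> = (\<Sum>g\<in>arcs G. if e = g then f g else 0)" by (intro sum.cong) auto
  finally show ?thesis using assms by simp
qed

text \<open>Each row of \<open>X\<close> has one unit entry in either block, so \<open>X Y\<close>
  adds a tail contribution and a head contribution. These are the two bracketed groups of
  \<open>cube_support_entry\<close>, and the remaining term is \<open>- 2 J\<close>.\<close>

lemma support_cube_eq: "support_cube = endpoints * coendpoints - 2 \<cdot>\<^sub>m reversal"
proof (rule eq_matI)
  fix i j assume "i < dim_row (endpoints * coendpoints - 2 \<cdot>\<^sub>m reversal)"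
    "j < dim_col (endpoints * coendpoints - 2 \<cdot>\<^sub>m reversal)"
  then have ij: "i < N" "j < N" using carriers by auto
  have verts: "tail G (es ! i) \<in> verts G" "head G (es ! i) \<in> verts G" using ij by auto
  have "(endpoints * coendpoints) $$ (i, j) = (\<Sum>l<n + n. endpoints $$ (i, l) * coendpoints $$ (l, j))"
    by (rule index_mult_mat_sum[OF carriers(4,5) ij])
  also have "\<dots> = (\<Sum>l<n. of_bool (tail G (es ! i) = vs ! l) * coendpoint_tail (vs ! l) (es ! j))
      + (\<Sum>l<n. of_bool (head G (es ! i) = vs ! l) * coendpoint_head (vs ! l) (es ! j))"
    unfolding sum_split using ij by (simp add: endpoints_def coendpoints_def)
  also have "\<dots> = coendpoint_tail (tail G (es ! i)) (es ! j) + coendpoint_head (head G (es ! i)) (es ! j)"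
    unfolding sum_delta_vs[OF verts(1), where f = "\<lambda>v. coendpoint_tail v (es ! j)"]
      sum_delta_vs[OF verts(2), where f = "\<lambda>v. coendpoint_head v (es ! j)"] ..
  finally have XY: "(endpoints * coendpoints) $$ (i, j) = \<dots>" .
  have minus: "(endpoints * coendpoints - 2 \<cdot>\<^sub>m reversal) $$ (i, j) =
      (endpoints * coendpoints) $$ (i, j) - 2 * of_bool (es ! j = arev (es ! i))"
    using ij by (simp add: reversal_def del: index_mult_mat(1))
  have dims: "dim_row (grover_mat G arev es) = N" "dim_col (grover_mat G arev es) = N"
    by (simp_all add: grover_mat_def)
  have "support_cube $$ (i, j) = (if grover_cube_entry (es ! i) (es ! j) > 0 then 1 else 0)"
    using ij grover_mat_cube_index[OF ij] by (simp add: support_cube_def pos_support_def dims)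
  also have "\<dots> = of_int (if grover_cube_entry (es ! i) (es ! j) > 0 then 1 else 0)" by simp
  also have "\<dots> = of_int (cube_support_entry (es ! i) (es ! j))"
    using ij by (subst cube_support) auto
  also have "\<dots> = (endpoints * coendpoints - 2 \<cdot>\<^sub>m reversal) $$ (i, j)"
    unfolding minus XY by (simp add: cube_support_entry_def coendpoint_tail_def coendpoint_head_def)
  finally show "support_cube $$ (i, j) = (endpoints * coendpoints - 2 \<cdot>\<^sub>m reversal) $$ (i, j)" .
qed (use carriers in auto)

lemma reversal_square: "reversal * reversal = 1\<^sub>m N"
proof (rule eq_matI)
  fix i j assume "i < dim_row (1\<^sub>m N :: complex mat)" "j < dim_col (1\<^sub>m N :: complex mat)"
  then have ij: "i < N" "j < N" by auto
  have "(reversal * reversal) $$ (i, j) = (\<Sum>l<N. of_bool (es ! l = arev (es ! i)) * of_bool (es ! j = arev (es ! l)))"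
    unfolding index_mult_mat_sum[OF carriers(3,3) ij] using ij by (simp add: reversal_def)
  also have "\<dots> = of_bool (es ! j = arev (arev (es ! i)))"
    using ij by (intro sum_delta_es) simp
  finally show "(reversal * reversal) $$ (i, j) = 1\<^sub>m N $$ (i, j)"
    using ij nth_eq_iff_index_eq[OF es(1), of j i] by (auto simp del: index_mult_mat(1))
qed (use carriers in auto)

lemma swap_square: "swap * swap = 1\<^sub>m (n + n)"
  unfolding swap_def
  by (subst mult_four_block_mat[of _ n n _ n _ n _ _ n _ n]) simp_all

text \<open>Reversing an arc exchanges its tail and head. This is the hypothesis
  \<open>J X = X S\<close> of \<open>det_involution_twist\<close>.\<close>

lemma reversal_endpoints: "reversal * endpoints = endpoints * swap"
proof (rule eq_matI)
  fix i j assume "i < dim_row (endpoints * swap)" "j < dim_col (endpoints * swap)"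
  then have ij: "i < N" "j < n + n" using carriers by auto
  let ?p = "\<lambda>e j. of_bool (if j < n then tail G e = vs ! j else head G e = vs ! (j - n)) :: complex"
  have "(reversal * endpoints) $$ (i, j) = (\<Sum>l<N. of_bool (es ! l = arev (es ! i)) * ?p (es ! l) j)"
    unfolding index_mult_mat_sum[OF carriers(3,4) ij] using ij by (simp add: reversal_def endpoints_def)
  also have "\<dots> = ?p (arev (es ! i)) j"
    using ij by (intro sum_delta_es) simp
  \<comment> \<open>The conditional names the column of the same vertex in the other block.\<close>
  also have "\<dots> = ?p (es ! i) (if j < n then n + j else j - n)"
    using ij by (cases "j < n") auto
  also have "\<dots> = (\<Sum>l<n + n. of_bool (l = (if j < n then n + j else j - n)) * ?p (es ! i) l)"
    by (subst sum.mono_neutral_right[of _ "{if j < n then n + j else j - n}"]) (use ij in auto)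
  also have "\<dots> = (endpoints * swap) $$ (i, j)"
    unfolding index_mult_mat_sum[OF carriers(4,6) ij] using ij
    by (intro sum.cong refl) (auto simp: endpoints_def swap_def)
  finally show "(reversal * endpoints) $$ (i, j) = (endpoints * swap) $$ (i, j)" .
qed (use carriers in auto)

end

context enumerated_c4_free_regular_graph
begin

text \<open>\<open>I + J = L L\<^sup>t\<close> and \<open>L\<^sup>t L = 2 I\<close> for the incidence matrix \<open>L\<close> of arcs and unoriented edges.\<close>
lemma det_one_minus_reversal:
  assumes t: "1 + t \<noteq> 0"
  shows "det (1\<^sub>m N - t \<cdot>\<^sub>m reversal) = (1 - t\<^sup>2) ^ num_edges G arev"
proof -
  let ?m = "num_edges G arev"
  have "finite (uedges G arev)" by (simp add: uedges_def)
  then obtain Es where Es: "distinct Es" "set Es = uedges G arev"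
    using finite_distinct_list by blast
  then have len: "length Es = ?m"
    using distinct_card num_edges_def by metis
  define L :: "complex mat" where "L = mat N ?m (\<lambda>(i, j). of_bool (es ! i \<in> Es ! j))"
  have L: "L \<in> carrier_mat N ?m" by (simp add: L_def)
  then have LT: "L\<^sup>T \<in> carrier_mat ?m N" by simp
  have LLT: "L * L\<^sup>T = 1\<^sub>m N + reversal"
  proof (rule eq_matI)
    fix i j assume "i < dim_row (1\<^sub>m N + reversal)" "j < dim_col (1\<^sub>m N + reversal)"
    then have ij: "i < N" "j < N" using carriers by auto
    let ?E = "{es ! i, arev (es ! i)}"
    have E: "?E \<in> uedges G arev" using ij by (auto simp: uedges_def)
    have "(L * L\<^sup>T) $$ (i, j) = (\<Sum>l<?m. of_bool (es ! i \<in> Es ! l) * of_bool (es ! j \<in> Es ! l))"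
      unfolding index_mult_mat_sum[OF L LT ij] using ij by (simp add: L_def)
    also have "\<dots> = (\<Sum>E\<in>uedges G arev. of_bool (es ! i \<in> E) * of_bool (es ! j \<in> E))"
      using sum_nth_distinct[OF Es(1), where f = "\<lambda>E. of_bool (es ! i \<in> E) * of_bool (es ! j \<in> E)"] Es(2) len
      by (simp only:)
    also have "\<dots> = (\<Sum>E\<in>uedges G arev. if E = ?E then of_bool (es ! j \<in> E) else 0)"
    proof (intro sum.cong refl)
      fix E assume "E \<in> uedges G arev"
      then have iff: "es ! i \<in> E \<longleftrightarrow> E = ?E" using uedge_props(3) by blast
      have "of_bool B * x = (if B then x else 0)" for B and x :: complex by simp
      then show "of_bool (es ! i \<in> E) * of_bool (es ! j \<in> E) = (if E = ?E then of_bool (es ! j \<in> E) else 0 :: complex)"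
        unfolding iff .
    qed
    also have "\<dots> = of_bool (es ! j \<in> ?E)"
      using E by (simp add: uedges_def)
    also have "\<dots> = of_bool (j = i) + of_bool (es ! j = arev (es ! i))"
      using ij arev_neq[of "es ! i"] nth_eq_iff_index_eq[OF es(1), of j i] by auto
    finally show "(L * L\<^sup>T) $$ (i, j) = (1\<^sub>m N + reversal) $$ (i, j)"
      using ij by (auto simp: reversal_def)
  qed (use L carriers in auto)
  have LTL: "L\<^sup>T * L = 2 \<cdot>\<^sub>m 1\<^sub>m ?m"
  proof (rule eq_matI)
    fix i j assume "i < dim_row (2 \<cdot>\<^sub>m 1\<^sub>m ?m :: complex mat)" "j < dim_col (2 \<cdot>\<^sub>m 1\<^sub>m ?m :: complex mat)"
    then have ij: "i < ?m" "j < ?m" by auto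
    then have E: "Es ! i \<in> uedges G arev" "Es ! j \<in> uedges G arev"
      using Es(2) len nth_mem by metis+
    have "(L\<^sup>T * L) $$ (i, j) = (\<Sum>l<N. of_bool (es ! l \<in> Es ! i) * of_bool (es ! l \<in> Es ! j))"
      unfolding index_mult_mat_sum[OF LT L ij] using ij by (simp add: L_def)
    also have "\<dots> = (\<Sum>e\<in>arcs G. of_bool (e \<in> Es ! i) * of_bool (e \<in> Es ! j))"
      by (rule sum_es)
    also have "\<dots> = (\<Sum>e\<in>arcs G. of_bool (e \<in> Es ! i \<inter> Es ! j))"
      by (intro sum.cong refl) auto
    also have "\<dots> = of_nat (card (Es ! i \<inter> Es ! j))"
    proof -
      have "arcs G \<inter> {e. e \<in> Es ! i \<inter> Es ! j} = Es ! i \<inter> Es ! j"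
        using uedge_props(1)[OF E(1)] by blast
      then show ?thesis by (simp only: sum_of_bool_eq finite_arcs)
    qed
    also have "\<dots> = (if i = j then 2 else 0)"
    proof (cases "i = j")
      case False
      then have "Es ! i \<noteq> Es ! j" using ij len Es(1) nth_eq_iff_index_eq by metis
      then have "Es ! i \<inter> Es ! j = {}" using uedge_props(3)[OF E(1)] uedge_props(3)[OF E(2)] by blast
      then show ?thesis using False by simp
    qed (use uedge_props(2)[OF E(1)] in simp)
    finally show "(L\<^sup>T * L) $$ (i, j) = (2 \<cdot>\<^sub>m 1\<^sub>m ?m) $$ (i, j)"
      using ij by simp
  qed (use L in auto)
  have tL: "t \<cdot>\<^sub>m L \<in> carrier_mat N ?m" using L by simp
  \<comment> \<open>Substituting \<open>J = L L\<^sup>t - I\<close> makes the scalar part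
    \<open>1 + t\<close>, which is nonzero as the Weinstein-Aronszajn identity demands.\<close>
  have "(1 + t) \<cdot>\<^sub>m 1\<^sub>m N - (t \<cdot>\<^sub>m L) * L\<^sup>T = 1\<^sub>m N - t \<cdot>\<^sub>m reversal"
    unfolding mult_smult_assoc_mat[OF L LT] LLT
    using carriers by (auto intro!: eq_matI simp: algebra_simps)
  moreover have "(1 + t) \<cdot>\<^sub>m 1\<^sub>m ?m - L\<^sup>T * (t \<cdot>\<^sub>m L) = (1 - t) \<cdot>\<^sub>m 1\<^sub>m ?m"
    unfolding mult_smult_distrib[OF LT L] LTL
    by (auto intro!: eq_matI)
  ultimately have "det (1\<^sub>m N - t \<cdot>\<^sub>m reversal) * (1 + t) ^ ?m = (1 + t) ^ N * (1 - t) ^ ?m"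
    using det_weinstein_aronszajn[OF tL LT t] by simp
  \<comment> \<open>By \<open>N = 2 m\<close> a factor \<open>(1 + t) ^ ?m\<close> can be split off
    and cancelled.\<close>
  also have "\<dots> = ((1 - t) * (1 + t)) ^ ?m * (1 + t) ^ ?m"
    by (simp add: length_es mult_2 power_add power_mult_distrib)
  finally show ?thesis
    using t by (simp add: power2_eq_square algebra_simps)
qed

section \<open>The blocks of \<open>Y X\<close> as polynomials in the adjacency matrix\<close>

lemma adj_index: "i < n \<Longrightarrow> j < n \<Longrightarrow> adj $$ (i, j) = of_nat (arc_count G (vs ! i) (vs ! j))"
  by (simp add: adj_def adjacency_mat_def arc_count_def)

lemma adj2_index:
  assumes "i < n" "j < n"
  shows "(adj * adj) $$ (i, j) = of_nat (walk2_count G (vs ! i) (vs ! j))"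
proof -
  have "(adj * adj) $$ (i, j) = (\<Sum>l<n. of_nat (arc_count G (vs ! i) (vs ! l) * arc_count G (vs ! l) (vs ! j)))"
    unfolding index_mult_mat_sum[OF carriers(2,2) assms] using assms by (simp add: adj_index)
  also have "\<dots> = (\<Sum>z\<in>verts G. of_nat (arc_count G (vs ! i) z * arc_count G z (vs ! j)))"
    by (rule sum_vs)
  finally show ?thesis by (simp add: walk2_count_def)
qed

lemma adj3_index:
  assumes "i < n" "j < n"
  shows "(adj * adj * adj) $$ (i, j) =
    (\<Sum>z\<in>verts G. of_nat (arc_count G (vs ! j) z) * of_nat (walk2_count G (vs ! i) z))"
proof -
  have "(adj * adj * adj) $$ (i, j) =
      (\<Sum>l<n. of_nat (arc_count G (vs ! j) (vs ! l)) * of_nat (walk2_count G (vs ! i) (vs ! l)))"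
    unfolding index_mult_mat_sum[OF mult_carrier_mat[OF carriers(2,2)] carriers(2) assms]
    using assms by (intro sum.cong refl) (simp add: adj_index adj2_index arc_count_sym[of "vs ! j"] del: index_mult_mat(1))
  then show ?thesis
    using sum_vs[of "\<lambda>z. of_nat (arc_count G (vs ! j) z) * (of_nat (walk2_count G (vs ! i) z) :: complex)"]
    by (simp only:)
qed

lemma walk2_count_eq_sum_out:
  "(\<Sum>e | e \<in> arcs G \<and> tail G e = w. of_nat (arc_count G v (head G e))) = (of_nat (walk2_count G v w) :: complex)"
  unfolding sum_out_arcs[where f = "\<lambda>z. of_nat (arc_count G v z)"] walk2_count_def
  by (simp add: arc_count_sym[of w] mult.commute)

lemma sum_out_arcs_delta:
  assumes "v \<in> verts G"
  shows "(\<Sum>e | e \<in> arcs G \<and> tail G e = w. of_bool (v = head G e)) = (of_nat (arc_count G w v) :: complex)"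
proof -
  have "(\<Sum>e | e \<in> arcs G \<and> tail G e = w. of_bool (v = head G e)) =
      (\<Sum>z\<in>verts G. of_nat (arc_count G w z) * (of_bool (v = z) :: complex))"
    by (rule sum_out_arcs)
  also have "\<dots> = (\<Sum>z\<in>verts G. if v = z then of_nat (arc_count G w z) else 0)"
    by (intro sum.cong) auto
  finally show ?thesis using assms by simp
qed

lemma sum_in_arcs_delta:
  assumes "v \<in> verts G"
  shows "(\<Sum>e | e \<in> arcs G \<and> head G e = w. of_bool (v = tail G e)) = (of_nat (arc_count G w v) :: complex)"
  unfolding sum_in_arcs[where f = "\<lambda>z. of_bool (v = z)"]
    sum_out_arcs[where f = "\<lambda>z. of_bool (v = z)", symmetric] by (rule sum_out_arcs_delta[OF assms])

text \<open>This and the next three lemmas are the blocks of \<open>Y X\<close>, row by row: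
  \<open>A\<^sup>3 + (2 - 2 k) A\<close>, \<open>(k - 1) A\<^sup>2 + (2 - k) k I\<close>,
  \<open>2 k I - A\<^sup>2\<close> and \<open>(2 - k) A\<close>. Summing over arcs out of
  \<open>w\<close> multiplies by \<open>S\<close>, summing over arcs into \<open>w\<close>
  multiplies by \<open>H\<close>.\<close>

lemma sum_coendpoint_tail_out:
  assumes "v \<in> verts G" "w \<in> verts G"
  shows "(\<Sum>g | g \<in> arcs G \<and> tail G g = w. coendpoint_tail v g) =
    (\<Sum>z\<in>verts G. of_nat (arc_count G w z) * of_nat (walk2_count G v z))
      + (2 - 2 * of_nat k) * of_nat (arc_count G v w)"
proof -
  have "(\<Sum>g | g \<in> arcs G \<and> tail G g = w. coendpoint_tail v g) =
      (\<Sum>g | g \<in> arcs G \<and> tail G g = w. of_nat (walk2_count G v (head G g)))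
      + (2 - of_nat k) * (\<Sum>g | g \<in> arcs G \<and> tail G g = w. of_bool (v = head G g))
      - (\<Sum>g | g \<in> arcs G \<and> tail G g = w. of_nat (arc_count G v w))"
    unfolding sum_distrib_left sum.distrib[symmetric] sum_subtractf[symmetric]
    by (intro sum.cong refl) (auto simp: coendpoint_tail_def)
  then show ?thesis
    unfolding sum_out_arcs[where f = "\<lambda>z. of_nat (walk2_count G v z)"] sum_out_arcs_delta[OF assms(1)]
    by (simp add: out_degree_eq[OF assms(2)] arc_count_sym[of w v] algebra_simps)
qed

lemma sum_coendpoint_tail_in:
  assumes "v \<in> verts G" "w \<in> verts G"
  shows "(\<Sum>g | g \<in> arcs G \<and> head G g = w. coendpoint_tail v g) =
    (of_nat k - 1) * of_nat (walk2_count G v w) + (2 - of_nat k) * of_nat k * of_bool (v = w)"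
proof -
  have "(\<Sum>g | g \<in> arcs G \<and> head G g = w. coendpoint_tail v g) =
      (\<Sum>g | g \<in> arcs G \<and> head G g = w. of_nat (walk2_count G v w) + (2 - of_nat k) * of_bool (v = w))
      - (\<Sum>g | g \<in> arcs G \<and> head G g = w. of_nat (arc_count G v (tail G g)))"
    unfolding sum_subtractf[symmetric]
    by (intro sum.cong refl) (auto simp: coendpoint_tail_def)
  then show ?thesis
    unfolding walk2_count_eq_sum_in
    by (simp add: in_degree_eq[OF assms(2)] algebra_simps)
qed

lemma sum_coendpoint_head_out:
  assumes "v \<in> verts G" "w \<in> verts G"
  shows "(\<Sum>g | g \<in> arcs G \<and> tail G g = w. coendpoint_head v g) =
    2 * of_nat k * of_bool (v = w) - of_nat (walk2_count G v w)"
proof -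
  have "(\<Sum>g | g \<in> arcs G \<and> tail G g = w. coendpoint_head v g) =
      (\<Sum>g | g \<in> arcs G \<and> tail G g = w. 2 * of_bool (v = w))
      - (\<Sum>g | g \<in> arcs G \<and> tail G g = w. of_nat (arc_count G v (head G g)))"
    unfolding sum_subtractf[symmetric]
    by (intro sum.cong refl) (auto simp: coendpoint_head_def)
  then show ?thesis
    unfolding walk2_count_eq_sum_out
    by (simp add: out_degree_eq[OF assms(2)])
qed

lemma sum_coendpoint_head_in:
  assumes "v \<in> verts G" "w \<in> verts G"
  shows "(\<Sum>g | g \<in> arcs G \<and> head G g = w. coendpoint_head v g) =
    (2 - of_nat k) * of_nat (arc_count G v w)"
proof -
  have "(\<Sum>g | g \<in> arcs G \<and> head G g = w. coendpoint_head v g) =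
      2 * (\<Sum>g | g \<in> arcs G \<and> head G g = w. of_bool (v = tail G g))
      - (\<Sum>g | g \<in> arcs G \<and> head G g = w. of_nat (arc_count G v w))"
    unfolding sum_distrib_left sum_subtractf[symmetric]
    by (intro sum.cong refl) (auto simp: coendpoint_head_def)
  then show ?thesis
    unfolding sum_in_arcs_delta[OF assms(1)]
    by (simp add: in_degree_eq[OF assms(2)] arc_count_sym[of w v] algebra_simps)
qed

lemma coendpoints_endpoints_index:
  assumes "i < n + n" "j < n + n"
  shows "(coendpoints * endpoints) $$ (i, j) =
    (\<Sum>g | g \<in> arcs G \<and> (if j < n then tail G g = vs ! j else head G g = vs ! (j - n)).
       if i < n then coendpoint_tail (vs ! i) g else coendpoint_head (vs ! (i - n)) g)"
proof -
  let ?c = "\<lambda>g. if i < n then coendpoint_tail (vs ! i) g else coendpoint_head (vs ! (i - n)) g"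
  let ?p = "\<lambda>g. if j < n then tail G g = vs ! j else head G g = vs ! (j - n)"
  have "(coendpoints * endpoints) $$ (i, j) = (\<Sum>l<N. if ?p (es ! l) then ?c (es ! l) else 0)"
    unfolding index_mult_mat_sum[OF carriers(5,4) assms]
    using assms by (intro sum.cong refl) (auto simp: coendpoints_def endpoints_def)
  also have "\<dots> = (\<Sum>g\<in>arcs G. if ?p g then ?c g else 0)"
    by (rule sum_es)
  also have "\<dots> = (\<Sum>g | g \<in> arcs G \<and> ?p g. ?c g)"
    by (rule sum.inter_filter[symmetric]) simp
  finally show ?thesis .
qed

text \<open>The matrix \<open>1 + t S - Y X\<close> of \<open>det_involution_twist\<close> for
  \<open>t = 2 u\<close> and \<open>u Y\<close> in place of \<open>Y\<close>. The summand
  \<open>2 * u\<close> in the off-diagonal blocks comes from \<open>swap\<close>.\<close>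

lemma vertex_blocks:
  "1\<^sub>m (n + n) + (2 * u) \<cdot>\<^sub>m swap - (u \<cdot>\<^sub>m coendpoints) * endpoints =
    four_block_mat
      (1\<^sub>m n + (- u * (2 - 2 * of_nat k)) \<cdot>\<^sub>m adj + (- u) \<cdot>\<^sub>m (adj * adj * adj))
      ((2 * u - u * ((2 - of_nat k) * of_nat k)) \<cdot>\<^sub>m 1\<^sub>m n + (- u * (of_nat k - 1)) \<cdot>\<^sub>m (adj * adj))
      ((2 * u - u * (2 * of_nat k)) \<cdot>\<^sub>m 1\<^sub>m n + u \<cdot>\<^sub>m (adj * adj))
      (1\<^sub>m n + (- u * (2 - of_nat k)) \<cdot>\<^sub>m adj)" (is "?L = ?R")
proof (rule eq_matI)
  have A: "dim_row adj = n" "dim_col adj = n" using carriers by auto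
  fix i j assume "i < dim_row ?R" "j < dim_col ?R"
  then have ij: "i < n + n" "j < n + n" using A by auto
  have L: "?L $$ (i, j) = of_bool (i = j) + 2 * u * swap $$ (i, j) - u * (coendpoints * endpoints) $$ (i, j)"
    unfolding mult_smult_assoc_mat[OF carriers(5,4)]
    using ij carriers by (simp del: index_mult_mat(1))
  note simps = swap_def adj_index adj2_index adj3_index A nth_eq_iff_index_eq[OF vs(1)]
    coendpoints_endpoints_index sum_coendpoint_tail_out sum_coendpoint_tail_in
    sum_coendpoint_head_out sum_coendpoint_head_in
  show "?L $$ (i, j) = ?R $$ (i, j)"
  proof (cases "i < n")
    case i: True
    show ?thesis
    proof (cases "j < n")
      case True
      then show ?thesis unfolding L using i ij by (simp add: simps algebra_simps del: index_mult_mat(1))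
    next
      case False
      then have j: "\<not> j < n" "j - n < n" using ij by auto
      then show ?thesis unfolding L using i ij by (auto simp: simps algebra_simps simp del: index_mult_mat(1))
    qed
  next
    case False
    then have i: "\<not> i < n" "i - n < n" using ij by auto
    show ?thesis
    proof (cases "j < n")
      case True
      then show ?thesis unfolding L using i ij by (auto simp: simps algebra_simps simp del: index_mult_mat(1))
    next
      case False
      then have j: "\<not> j < n" "j - n < n" using ij by auto
      then show ?thesis unfolding L using i ij by (auto simp: simps algebra_simps simp del: index_mult_mat(1))
    qed
  qed
qed (use carriers in auto)

text \<open>Since \<open>u (X Y - 2 J)\<close> is subtracted from \<open>1\<close>, the twisted
  identity applies with \<open>t = 2 u\<close>. The determinants of \<open>1 - t J\<close> and
  \<open>1 - t S\<close> are \<open>?c ^ ?m\<close> and \<open>?c ^ n\<close>, and the surplus power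
  of \<open>?c\<close> is \<open>2 m + n - (m + 2 n) = m - n\<close>.\<close>

lemma det_support_cube:
  assumes u: "1 - 4 * u\<^sup>2 \<noteq> 0"
  shows "det (1\<^sub>m N - u \<cdot>\<^sub>m support_cube) = (1 - 4 * u\<^sup>2) ^ (num_edges G arev - n) *
    (\<Prod>l\<in>#proots (char_poly adj). 1 - rho3_trace k l * u + rho3_den k l * u\<^sup>2)"
    (is "?D = ?c ^ (?m - n) * ?P")
proof -
  have c: "1 - (2 * u)\<^sup>2 = ?c" by (simp add: power_mult_distrib)
  have t: "1 - (2 * u)\<^sup>2 \<noteq> 0" using u c by simp
  have "1 - (2 * u)\<^sup>2 = (1 + 2 * u) * (1 - 2 * u)"
    by (simp add: power2_eq_square algebra_simps)
  with t have t1: "1 + 2 * u \<noteq> 0" by auto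
  have uY: "u \<cdot>\<^sub>m coendpoints \<in> carrier_mat (n + n) N" using carriers by simp
  have "1\<^sub>m N + (2 * u) \<cdot>\<^sub>m reversal - endpoints * (u \<cdot>\<^sub>m coendpoints) = 1\<^sub>m N - u \<cdot>\<^sub>m support_cube"
    unfolding support_cube_eq mult_smult_distrib[OF carriers(4,5)]
    using carriers by (auto intro!: eq_matI simp: algebra_simps simp del: index_mult_mat(1))
  moreover have "1\<^sub>m (n + n) - (2 * u) \<cdot>\<^sub>m swap =
      four_block_mat (1\<^sub>m n) (- (2 * u) \<cdot>\<^sub>m 1\<^sub>m n) (- (2 * u) \<cdot>\<^sub>m 1\<^sub>m n) (1\<^sub>m n)"
    by (rule eq_matI) (auto simp: swap_def)
  moreover have "det (1\<^sub>m (n + n) + (2 * u) \<cdot>\<^sub>m swap - (u \<cdot>\<^sub>m coendpoints) * endpoints) = ?P"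
    unfolding vertex_blocks det_commuting_blocks[OF carriers(2)]
    by (intro arg_cong[where f = prod_mset] image_mset_cong)
      (simp add: rho3_trace_def rho3_den_def algebra_simps power2_eq_square power4_eq_xxxx)
  ultimately have "?c ^ ?m * ?D * ?c ^ (n + n) = ?c ^ N * (?c ^ n * ?P)"
    using det_involution_twist[OF carriers(4) uY carriers(3) reversal_square carriers(6) swap_square
        reversal_endpoints t]
    by (simp add: det_one_minus_reversal[OF t1] det_one_minus_swap c)
  moreover have "?c ^ N * (?c ^ n * ?P) = ?c ^ (?m + (n + n)) * (?c ^ (?m - n) * ?P)"
  proof -
    have "N + n = ?m + (n + n) + (?m - n)"
      using card_verts_le_num_edges length_es length_vs by linarith
    then show ?thesis unfolding mult.assoc[symmetric] power_add[symmetric] by (simp only:)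
  qed
  moreover have "?c ^ ?m * ?D * ?c ^ (n + n) = ?c ^ (?m + (n + n)) * ?D"
    unfolding power_add[of _ ?m] by (simp only: ac_simps)
  ultimately have "?c ^ (?m + (n + n)) * ?D = ?c ^ (?m + (n + n)) * (?c ^ (?m - n) * ?P)"
    by (simp only:)
  then show ?thesis
    unfolding mult_left_cancel[OF power_not_zero[OF u]] .
qed

end

section \<open>Poles\<close>

lemma eventually_poly_nonzero:
  fixes p :: "complex poly"
  assumes "p \<noteq> 0"
  shows "\<forall>\<^sub>F w in at z. poly p w \<noteq> 0"
  using islimpt_finite[OF poly_roots_finite[OF assms], of z] by (simp add: islimpt_iff_eventually)

text \<open>Splitting off \<open>(w - z) ^ a\<close> leaves a factor \<open>q\<close> with
  \<open>q(z) \<noteq> 0\<close>, whose inverse is holomorphic near \<open>z\<close>, so the order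
  of the inverse polynomial is \<open>- a\<close>. Agreement with \<open>f\<close> is asked only on
  a punctured neighbourhood, which still covers \<open>z = 1 / 2\<close> and
  \<open>z = - 1 / 2\<close>.\<close>

lemma pole_mult_inverse_poly:
  fixes p :: "complex poly"
  assumes p: "p \<noteq> 0" and f: "\<forall>\<^sub>F w in at z. f w = inverse (poly p w)"
  shows "pole_mult f z = Polynomial.order z p"
proof -
  let ?g = "\<lambda>w. inverse (poly p w)"
  define a where "a = Polynomial.order z p"
  obtain q where q: "p = [:- z, 1:] ^ a * q" "\<not> [:- z, 1:] dvd q"
    using order_decomp[OF p] a_def by blast
  have qz: "poly q z \<noteq> 0" using q(2) by (simp add: poly_eq_0_iff_dvd)
  have zorder: "zorder ?g z = - int a"
  proof (rule zorder_eqI)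
    show "open {w. poly q w \<noteq> 0}"
      by (intro open_Collect_neq continuous_intros)
    show "(\<lambda>w. inverse (poly q w)) holomorphic_on {w. poly q w \<noteq> 0}"
      by (intro holomorphic_intros) auto
    \<comment> \<open>This holds even at zeros of \<open>p\<close>, because
      \<open>inverse 0 = 0\<close>.\<close>
    show "?g w = inverse (poly q w) * (w - z) powi (- int a)" for w
      by (simp add: q(1) power_int_minus poly_power)
  qed (use qz in auto)
  have lim: "(poly p \<longlongrightarrow> poly p z) (at z)"
    using poly_isCont isCont_def by blast
  have pole: "is_pole ?g z \<longleftrightarrow> a > 0"
  proof
    assume "a > 0"
    then have "poly p z = 0" using p order_gt_0_iff[of p z] by (simp add: a_def)
    moreover have "\<forall>\<^sub>F w in at z. poly p w \<noteq> 0"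
      using p by (rule eventually_poly_nonzero)
    ultimately have "filterlim (poly p) (at 0) (at z)"
      using lim by (simp add: filterlim_at)
    then show "is_pole ?g z"
      unfolding is_pole_def by (rule filterlim_compose[OF filterlim_inverse_at_infinity])
  next
    assume pole: "is_pole ?g z"
    show "a > 0"
    proof (rule ccontr)
      assume "\<not> a > 0"
      then have "poly p z \<noteq> 0" using p order_gt_0_iff[of p z] by (simp add: a_def)
      then have "(?g \<longlongrightarrow> inverse (poly p z)) (at z)" using lim by (intro tendsto_intros)
      then show False
        using pole not_tendsto_and_filterlim_at_infinity[of "at z"] by (auto simp: is_pole_def)
    qed
  qed
  have "pole_mult f z = pole_mult ?g z"
    unfolding pole_mult_def by (simp only: is_pole_cong[OF f refl] zorder_cong[OF f refl])
  then show ?thesis by (simp add: pole_mult_def pole zorder a_def)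
qed

text \<open>For a nonzero leading coefficient this is the quadratic formula, checked through the sum
  and product of the roots. Otherwise the polynomial drops to degree one or to the constant
  1.\<close>

lemma proots_rho3: "proots [:1, - rho3_trace k l, rho3_den k l:] = rho3_values k l"
proof -
  let ?t = "rho3_trace k l" and ?d = "rho3_den k l" and ?s = "csqrt (rho3_disc k l)"
  consider "?d \<noteq> 0" | "?d = 0" "?t \<noteq> 0" | "?d = 0" "?t = 0" by blast
  then show ?thesis
  proof cases
    case 1
    \<comment> \<open>The long radicand is the ordinary discriminant of the quadratic.\<close>
    have "rho3_disc k l = ?t\<^sup>2 - 4 * ?d"
      by (simp add: rho3_disc_def rho3_trace_def rho3_den_def power2_eq_square power4_eq_xxxx
          numeral_eq_Suc algebra_simps)
    then have s: "?s * ?s = ?t * ?t - 4 * ?d"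
      using power2_csqrt[of "rho3_disc k l"] by (simp add: power2_eq_square)
    have "[:1, - ?t, ?d:] = Polynomial.smult ?d ([:- rho3_plus k l, 1:] * [:- rho3_minus k l, 1:])"
    proof -
      have "?d * (rho3_plus k l + rho3_minus k l) = ?t"
        using 1 by (simp add: rho3_plus_def rho3_minus_def field_simps)
      moreover have "?d * (rho3_plus k l * rho3_minus k l) = (?t * ?t - ?s * ?s) / (4 * ?d)"
        using 1 by (simp add: rho3_plus_def rho3_minus_def field_simps)
      then have "?d * (rho3_plus k l * rho3_minus k l) = 1"
        using 1 by (simp add: s)
      ultimately show ?thesis by (simp add: algebra_simps)
    qed
    then have "proots [:1, - ?t, ?d:] = proots ([:- rho3_plus k l, 1:] * [:- rho3_minus k l, 1:])"
      using 1 by (simp only: proots_smult not_False_eq_True)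
    also have "\<dots> = proots [:- rho3_plus k l, 1:] + proots [:- rho3_minus k l, 1:]"
      by (rule proots_mult) simp_all
    finally have "proots [:1, - ?t, ?d:] = {#rho3_plus k l, rho3_minus k l#}"
      by (simp add: add_mset_commute)
    then show ?thesis using 1 by (simp add: rho3_values_def)
  next
    case 2
    then have "[:1, - ?t, ?d:] = Polynomial.smult (- ?t) [:- (1 / ?t), 1:]" by simp
    also have "proots \<dots> = {#1 / ?t#}" using 2(2) by (subst proots_smult) simp_all
    finally show ?thesis using 2 by (simp add: rho3_values_def)
  next
    case 3
    then show ?thesis by (simp add: rho3_values_def)
  qed
qed

lemma proots_quarter: "proots [:1, 0, -4 :: complex:] = {#1 / 2, - 1 / 2#}"
proof -
  have "[:1, 0, -4 :: complex:] = Polynomial.smult (-4) ([:- (1 / 2), 1:] * [:1 / 2, 1:])" by simp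
  also have "proots \<dots> = {#1 / 2, - 1 / 2#}"
    by (subst proots_smult, simp, subst proots_mult) simp_all
  finally show ?thesis .
qed

text \<open>Outside the points with \<open>1 = 4 u\<^sup>2\<close> the zeta function is the inverse
  of the polynomial \<open>Z\<close>, so its poles with multiplicity are the roots of
  \<open>Z\<close>. The conclusion has two forms: the formula with \<open>\<plusminus>\<close> when
  no denominator vanishes, and a general one in which roots that have moved to infinity are left
  out.\<close>

theorem theorem6p1:
  fixes G :: "('v, 'e) pre_digraph" and arev :: "'e \<Rightarrow> 'e"
    and vs :: "'v list" and es :: "'e list" and k n m :: nat
  assumes "fin_digraph G" and "bidirected_digraph G arev"
    and "Digraph_Component.connected G"
    and "regular G arev k" and "k > 2" and "girth G arev > 4"
    and "n = card (verts G)" and "m = num_edges G arev"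
    and "distinct vs" and "set vs = verts G"
    and "distinct es" and "set es = arcs G"
  shows "n \<le> m \<and>
    ((\<forall>l \<in># spectrum_mset (adjacency_mat G vs). rho3_den k l \<noteq> 0) \<longrightarrow>
      size (\<Sum>l\<in>#spectrum_mset (adjacency_mat G vs). {#rho3_plus k l, rho3_minus k l#}) = 2 * n \<and>
      (\<forall>z. pole_mult (zeta3 G arev es) z =
         count ((\<Sum>l\<in>#spectrum_mset (adjacency_mat G vs). {#rho3_plus k l, rho3_minus k l#})
                + replicate_mset (m - n) (1 / 2) + replicate_mset (m - n) (- 1 / 2)) z)) \<and>
    (\<forall>z. pole_mult (zeta3 G arev es) z =
       count ((\<Sum>l\<in>#spectrum_mset (adjacency_mat G vs). rho3_values k l)
              + replicate_mset (m - n) (1 / 2) + replicate_mset (m - n) (- 1 / 2)) z)"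
proof -
  interpret c4_free_regular_graph G arev k
    using assms by (intro c4_free_regular_graphI)
  interpret enumerated_c4_free_regular_graph G arev k vs es
    using assms by unfold_locales
  let ?spec = "spectrum_mset (adjacency_mat G vs)"
  define W where "W = (\<Prod>l\<in>#?spec. [:1, - rho3_trace k l, rho3_den k l:])"
  define Z where "Z = [:1, 0, -4 :: complex:] ^ (m - n) * W"
  have spec: "?spec = proots (char_poly adj)"
    by (simp add: spectrum_mset_def adj_def)
  have W: "W \<noteq> 0" "proots W = (\<Sum>l\<in>#?spec. rho3_values k l)"
  proof -
    \<comment> \<open>Every factor has constant coefficient 1, so it is nonzero even when its degree
      drops.\<close>
    have nz: "0 \<notin># image_mset (\<lambda>l. [:1, - rho3_trace k l, rho3_den k l:]) ?spec" by auto
    then show "W \<noteq> 0" unfolding W_def by (simp only: prod_mset_zero_iff not_False_eq_True)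
    show "proots W = (\<Sum>l\<in>#?spec. rho3_values k l)"
      unfolding W_def using proots_prod_mset[OF nz]
      by (simp add: image_mset.compositionality comp_def proots_rho3)
  qed
  have Z: "Z \<noteq> 0" using W by (simp add: Z_def)
  have rep: "repeat_mset (m - n) {#1 / 2, - 1 / 2 :: complex#} =
      replicate_mset (m - n) (1 / 2) + replicate_mset (m - n) (- 1 / 2)"
    by (rule multiset_eqI) simp
  have "proots Z = repeat_mset (m - n) (proots [:1, 0, -4:]) + proots W"
    unfolding Z_def using W by (subst proots_mult) (simp_all add: proots_power)
  then have proots_Z: "proots Z = (\<Sum>l\<in>#?spec. rho3_values k l) + replicate_mset (m - n) (1 / 2)
      + replicate_mset (m - n) (- 1 / 2)"
    unfolding proots_quarter rep W(2) by (simp only: ac_simps)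
  have poly_Z: "poly Z u = (1 - 4 * u\<^sup>2) ^ (m - n) *
      (\<Prod>l\<in>#?spec. 1 - rho3_trace k l * u + rho3_den k l * u\<^sup>2)" for u
    by (simp add: Z_def W_def poly_prod_mset poly_power image_mset.compositionality comp_def
        power2_eq_square algebra_simps)
  have zeta: "zeta3 G arev es u = inverse (poly Z u)" if "1 - 4 * u\<^sup>2 \<noteq> 0" for u
    using det_support_cube[OF that] assms(7,8) length_vs length_es
    by (simp add: zeta3_def poly_Z spec support_cube_def)
  have poles: "pole_mult (zeta3 G arev es) z = count (proots Z) z" for z
  proof -
    \<comment> \<open>The exceptional points are finitely many, so a punctured neighbourhood of any
      \<open>z\<close> avoids them, also when \<open>z\<close> is one of them.\<close>
    have "\<forall>\<^sub>F w in at z. poly [:1, 0, -4 :: complex:] w \<noteq> 0"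
      by (rule eventually_poly_nonzero) simp
    then have "\<forall>\<^sub>F w in at z. zeta3 G arev es w = inverse (poly Z w)"
      by eventually_elim (simp add: zeta power2_eq_square algebra_simps)
    then show ?thesis using pole_mult_inverse_poly[OF Z] Z by simp
  qed
  have "(\<Sum>l\<in>#?spec. rho3_values k l) = (\<Sum>l\<in>#?spec. {#rho3_plus k l, rho3_minus k l#})"
    if "\<forall>l\<in>#?spec. rho3_den k l \<noteq> 0"
    using that by (intro arg_cong[where f = sum_mset] image_mset_cong) (simp add: rho3_values_def)
  moreover have "size (\<Sum>l\<in>#?spec. {#rho3_plus k l, rho3_minus k l#}) = 2 * n"
  proof -
    have "size (\<Sum>l\<in>#?spec. {#rho3_plus k l, rho3_minus k l#}) = 2 * size ?spec"
    proof -
      have "size (\<Sum>l\<in>#M. {#rho3_plus k l, rho3_minus k l#}) = 2 * size M" for M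
        by (induction M) simp_all
      then show ?thesis .
    qed
    also have "size ?spec = n"
      using degree_monic_char_poly[OF carriers(2)] length_vs assms(7)
      by (simp add: spec size_proots_complex)
    finally show ?thesis .
  qed
  ultimately show ?thesis
    using card_verts_le_num_edges assms(7,8) by (simp add: poles proots_Z)
qed

end
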